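(* Let $A$ be the generator of a $C_0$-semigroup $T=(T(t))_{t\ge0}$ on a Banach space $X$. Let $q\in(1,\infty)$ and assume that the $q$-Weiss property for control operators holds for $A$. Let $U$ be a Banach space and $B\in\mathcal{L}(U,X_{-1})$. Then the following are equivalent: (a) $B$ is (infinite-time) $L^q$-admissible for $A$. (b) For all $u\in U$ with $\|u\|_U=1$ the input element $Bu\in X_{-1}$ is (infinite-time) $L^q$-admissible for $A$, and the admissibility constants $$C(u)=\inf\Big\{C>0:\ \forall t>0\ \forall v\in L^q([0,t])\ \ \Big\|\int_0^tT(t-s)Bu\,v(s)\,ds\Big\|_X\le C\|v\|_{L^q([0,t])}\Big\}$$ are bounded uniformly in $u\in U$, $\|u\|_U=1$.
   Context: $X_{-1}$ is the completion of $X$ with respect to $\|z\|_{X_{-1}}=\|(sI-A)^{-1}z\|_X$ for some fixed $s\in\rho(A)$; $T$ and the resolvent $R(\lambda,A)=(\lambda I-A)^{-1}$ extend to $X_{-1}$ (same notation), and $R(\lambda,A)$ maps $X_{-1}$ boundedly into $X$. For Banach spaces $V$ and $1\le p\le\infty$, an operator $B\in\mathcal{L}(V,X_{-1})$ is infinite-time $L^p$-admissible for $A$ (or for $T$) if for every $t\ge0$ and $u\in L^p([0,t],V)$ the integral $\int_0^tT(t-s)Bu(s)\,ds$ lies in $X$ and there is a constant $C>0$, independent of $t$, with $\|\int_0^tT(t-s)Bu(s)\,ds\|_X\le C\|u\|_{L^p([0,t],V)}$ for all such $t,u$. An element $b\in X_{-1}$ is identified with the operator $\mathbb{C}\to X_{-1}$,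 $z\mapsto zb$, and is called admissible if this operator is. The $p$-Weiss property for control operators holds for $A$ if for any Banach space $V$ and any $B\in\mathcal{L}(V,X_{-1})$: $B$ is infinite-time $L^p$-admissible if and only if $\sup_{\operatorname{Re}\lambda>0}(\operatorname{Re}\lambda)^{1/p}\|R(\lambda,A)B\|_{\mathcal{L}(V,X)}<\infty$, where the latter condition is understood to include $\{\operatorname{Re}\lambda>0\}\subset\rho(A)$. *)

theory Defs
  imports "HOL-Analysis.Analysis"
begin

subsection \<open>Complex Banach spaces\<close>

class complex_normed_vector = real_normed_vector +
  fixes scaleC :: "complex \<Rightarrow> 'a \<Rightarrow> 'a"  (infixr \<open>*\<^sub>C\<close> 75)
  assumes scaleC_add_right: "a *\<^sub>C (x + y) = a *\<^sub>C x + a *\<^sub>C y"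
    and scaleC_add_left: "(a + b) *\<^sub>C x = a *\<^sub>C x + b *\<^sub>C x"
    and scaleC_scaleC: "a *\<^sub>C b *\<^sub>C x = (a * b) *\<^sub>C x"
    and scaleC_one: "1 *\<^sub>C x = x"
    and scaleR_scaleC: "r *\<^sub>R x = complex_of_real r *\<^sub>C x"
    and norm_scaleC: "norm (a *\<^sub>C x) = cmod a * norm x"

class complex_banach = complex_normed_vector + banach

instantiation complex :: complex_banach
begin

definition scaleC_complex :: "complex \<Rightarrow> complex \<Rightarrow> complex"
  where "scaleC_complex a x = a * x"

instance
  by standard (simp_all add: scaleC_complex_def algebra_simps scaleR_conv_of_real norm_mult)

end

definition clinear :: "('a::complex_normed_vector \<Rightarrow> 'b::complex_normed_vector) \<Rightarrow> bool"
  where "clinear f \<longleftrightarrow>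
    (\<forall>x y. f (x + y) = f x + f y) \<and> (\<forall>c x. f (c *\<^sub>C x) = c *\<^sub>C f x)"

definition bounded_clinear :: "('a::complex_normed_vector \<Rightarrow> 'b::complex_normed_vector) \<Rightarrow> bool"
  where "bounded_clinear f \<longleftrightarrow> clinear f \<and> (\<exists>K. \<forall>x. norm (f x) \<le> K * norm x)"

text \<open>
  The Weiss property quantifies over all Banach spaces \<open>V\<close> inside a hypothesis, which is impossible
  for a type variable. Input spaces are therefore values: a carrier inside some type together with
  its operations. Nothing is required of the operations outside the carrier.
\<close>

record 'v normed_space =
  vcarrier :: "'v set"
  vadd :: "'v \<Rightarrow> 'v \<Rightarrow> 'v"
  vzero :: "'v"
  vscale :: "complex \<Rightarrow> 'v \<Rightarrow> 'v"
  vnorm :: "'v \<Rightarrow> real"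

definition vdist :: "'v normed_space \<Rightarrow> 'v \<Rightarrow> 'v \<Rightarrow> real"
  where "vdist V x y = vnorm V (vadd V x (vscale V (- 1) y))"

locale complex_banach_space =
  fixes V :: "'v normed_space"
  assumes add_closed: "\<lbrakk>x \<in> vcarrier V; y \<in> vcarrier V\<rbrakk> \<Longrightarrow> vadd V x y \<in> vcarrier V"
    and zero_closed: "vzero V \<in> vcarrier V"
    and scale_closed: "x \<in> vcarrier V \<Longrightarrow> vscale V a x \<in> vcarrier V"
    and add_assoc: "\<lbrakk>x \<in> vcarrier V; y \<in> vcarrier V; z \<in> vcarrier V\<rbrakk>
          \<Longrightarrow> vadd V (vadd V x y) z = vadd V x (vadd V y z)"
    and add_commute: "\<lbrakk>x \<in> vcarrier V; y \<in> vcarrier V\<rbrakk> \<Longrightarrow> vadd V x y = vadd V y x"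
    and add_zero: "x \<in> vcarrier V \<Longrightarrow> vadd V (vzero V) x = x"
    and add_inverse: "x \<in> vcarrier V \<Longrightarrow> vadd V x (vscale V (- 1) x) = vzero V"
    and scale_add_right: "\<lbrakk>x \<in> vcarrier V; y \<in> vcarrier V\<rbrakk>
          \<Longrightarrow> vscale V a (vadd V x y) = vadd V (vscale V a x) (vscale V a y)"
    and scale_add_left: "x \<in> vcarrier V
          \<Longrightarrow> vscale V (a + b) x = vadd V (vscale V a x) (vscale V b x)"
    and scale_scale: "x \<in> vcarrier V \<Longrightarrow> vscale V a (vscale V b x) = vscale V (a * b) x"
    and scale_one: "x \<in> vcarrier V \<Longrightarrow> vscale V 1 x = x"
    and norm_nonneg: "x \<in> vcarrier V \<Longrightarrow> 0 \<le> vnorm V x"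
    and norm_eq_zero: "x \<in> vcarrier V \<Longrightarrow> vnorm V x = 0 \<longleftrightarrow> x = vzero V"
    and norm_scale: "x \<in> vcarrier V \<Longrightarrow> vnorm V (vscale V a x) = cmod a * vnorm V x"
    and norm_triangle: "\<lbrakk>x \<in> vcarrier V; y \<in> vcarrier V\<rbrakk>
          \<Longrightarrow> vnorm V (vadd V x y) \<le> vnorm V x + vnorm V y"
    and complete: "\<lbrakk>\<And>n::nat. \<sigma> n \<in> vcarrier V;
            \<And>e. e > 0 \<Longrightarrow> \<exists>N. \<forall>m\<ge>N. \<forall>n\<ge>N. vdist V (\<sigma> m) (\<sigma> n) < e\<rbrakk>
          \<Longrightarrow> \<exists>x\<in>vcarrier V. (\<lambda>n. vdist V (\<sigma> n) x) \<longlonglongrightarrow> 0"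

definition type_space :: "'a::complex_banach normed_space"
  where "type_space =
    \<lparr>vcarrier = UNIV, vadd = (+), vzero = 0, vscale = scaleC, vnorm = norm\<rparr>"

lemma scaleC_minus1: "(- 1) *\<^sub>C x = - (x :: 'a::complex_normed_vector)"
  using scaleR_scaleC[of "- 1" x] by simp

lemma complex_banach_space_type_space:
  "complex_banach_space (type_space :: 'a::complex_banach normed_space)"
proof
  fix \<sigma> :: "nat \<Rightarrow> 'a"
  assume "\<And>e. e > 0 \<Longrightarrow>
    \<exists>N. \<forall>m\<ge>N. \<forall>n\<ge>N. vdist (type_space :: 'a normed_space) (\<sigma> m) (\<sigma> n) < e"
  then have "Cauchy \<sigma>"
    by (simp add: Cauchy_def vdist_def type_space_def scaleC_minus1 dist_norm)
  then obtain x where "\<sigma> \<longlonglongrightarrow> x"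
    using Cauchy_convergent convergent_def by blast
  then show "\<exists>x\<in>vcarrier type_space. (\<lambda>n. vdist type_space (\<sigma> n) x) \<longlonglongrightarrow> 0"
    by (auto simp: vdist_def type_space_def scaleC_minus1 tendsto_norm_zero_iff LIM_zero_iff)
qed (auto simp: type_space_def scaleC_minus1 algebra_simps scaleC_add_right scaleC_add_left
      scaleC_scaleC scaleC_one norm_scaleC norm_triangle_ineq)

text \<open>The set \<open>\<L>(V, Y)\<close> (only the values on the carrier of \<open>V\<close> matter) and its operator norm.\<close>

definition bounded_op :: "'v normed_space \<Rightarrow> ('v \<Rightarrow> 'y::complex_banach) \<Rightarrow> bool"
  where "bounded_op V B \<longleftrightarrow>
    (\<forall>x\<in>vcarrier V. \<forall>y\<in>vcarrier V. B (vadd V x y) = B x + B y) \<and>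
    (\<forall>c. \<forall>x\<in>vcarrier V. B (vscale V c x) = c *\<^sub>C B x) \<and>
    (\<exists>K. \<forall>x\<in>vcarrier V. norm (B x) \<le> K * vnorm V x)"

definition op_norm :: "'v normed_space \<Rightarrow> ('v \<Rightarrow> 'y::complex_banach) \<Rightarrow> real"
  where "op_norm V B = (SUP x\<in>vcarrier V. norm (B x) / vnorm V x)"

subsection \<open>Semigroups, generators and resolvents\<close>

text \<open>Only the values \<open>T t\<close> for \<open>t \<ge> 0\<close> are meaningful.\<close>

definition c0_semigroup :: "(real \<Rightarrow> 'x::complex_banach \<Rightarrow> 'x) \<Rightarrow> bool"
  where "c0_semigroup T \<longleftrightarrow>
    (\<forall>t\<ge>0. bounded_clinear (T t)) \<and>
    (\<forall>x. T 0 x = x) \<and>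
    (\<forall>s\<ge>0. \<forall>t\<ge>0. \<forall>x. T (s + t) x = T s (T t x)) \<and>
    (\<forall>x. ((\<lambda>t. T t x) \<longlongrightarrow> x) (at_right 0))"

text \<open>An unbounded operator is a domain \<open>D\<close> together with a function \<open>A\<close> used only on \<open>D\<close>.\<close>

definition is_generator ::
    "'x::complex_banach set \<Rightarrow> ('x \<Rightarrow> 'x) \<Rightarrow> (real \<Rightarrow> 'x \<Rightarrow> 'x) \<Rightarrow> bool"
  where "is_generator D A T \<longleftrightarrow>
    D = {x. \<exists>y. ((\<lambda>h. (1 / h) *\<^sub>R (T h x - x)) \<longlongrightarrow> y) (at_right 0)} \<and>
    (\<forall>x\<in>D. ((\<lambda>h. (1 / h) *\<^sub>R (T h x - x)) \<longlongrightarrow> A x) (at_right 0))"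

definition resolvent :: "'x::complex_banach set \<Rightarrow> ('x \<Rightarrow> 'x) \<Rightarrow> complex \<Rightarrow> 'x \<Rightarrow> 'x"
  where "resolvent D A l = inv_into D (\<lambda>x. l *\<^sub>C x - A x)"

definition resolvent_set :: "'x::complex_banach set \<Rightarrow> ('x \<Rightarrow> 'x) \<Rightarrow> complex set"
  where "resolvent_set D A =
    {l. bij_betw (\<lambda>x. l *\<^sub>C x - A x) D UNIV \<and> bounded_clinear (resolvent D A l)}"

subsection \<open>The extrapolation space\<close>

text \<open>
  \<open>X\<^sub>-\<^sub>1\<close> is a Banach space \<open>'y\<close> with an embedding \<open>j\<close> that exhibits it as a completion of \<open>X\<close>
  for the norm \<open>x \<mapsto> norm (R(s,A) x)\<close>. An element of \<open>X\<^sub>-\<^sub>1\<close> lies in \<open>X\<close> if it is in \<open>range j\<close>,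
  and its norm in \<open>X\<close> is then that of its preimage.
\<close>

definition is_extrapolation_space ::
    "'x::complex_banach set \<Rightarrow> ('x \<Rightarrow> 'x) \<Rightarrow> complex \<Rightarrow> ('x \<Rightarrow> 'y::complex_banach) \<Rightarrow> bool"
  where "is_extrapolation_space D A s j \<longleftrightarrow>
    s \<in> resolvent_set D A \<and> clinear j \<and>
    (\<forall>x. norm (j x) = norm (resolvent D A s x)) \<and> closure (range j) = UNIV"

definition X_norm :: "('x::complex_banach \<Rightarrow> 'y::complex_banach) \<Rightarrow> 'y \<Rightarrow> real"
  where "X_norm j y = norm (inv j y)"

text \<open>The unique bounded operator on \<open>X\<^sub>-\<^sub>1\<close> that agrees with \<open>f\<close> on \<open>X\<close>.\<close>

definition extension ::
    "('x::complex_banach \<Rightarrow> 'y::complex_banach) \<Rightarrow> ('x \<Rightarrow> 'z::complex_banach) \<Rightarrow> 'y \<Rightarrow> 'z"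
  where "extension j f = (THE g. bounded_clinear g \<and> (\<forall>x. g (j x) = f x))"

definition semigroup_ext ::
    "(real \<Rightarrow> 'x \<Rightarrow> 'x) \<Rightarrow> ('x::complex_banach \<Rightarrow> 'y::complex_banach) \<Rightarrow> real \<Rightarrow> 'y \<Rightarrow> 'y"
  where "semigroup_ext T j t = extension j (\<lambda>x. j (T t x))"

definition resolvent_ext ::
    "'x set \<Rightarrow> ('x \<Rightarrow> 'x) \<Rightarrow> ('x::complex_banach \<Rightarrow> 'y::complex_banach) \<Rightarrow> complex \<Rightarrow> 'y \<Rightarrow> 'x"
  where "resolvent_ext D A j l = extension j (resolvent D A l)"

subsection \<open>Vector-valued Lebesgue spaces\<close>

text \<open>
  Measurability is strong (Bochner) measurability: almost everywhere a limit of simple functions.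
  Elements are functions rather than classes modulo null sets. The exponent is finite.
\<close>

definition Lp_space :: "'v normed_space \<Rightarrow> real \<Rightarrow> real \<Rightarrow> (real \<Rightarrow> 'v) set"
  where "Lp_space V p t =
    {u. (\<forall>s\<in>{0..t}. u s \<in> vcarrier V) \<and>
        (\<exists>f :: nat \<Rightarrow> real \<Rightarrow> 'v.
           (\<forall>n. simple_function (lebesgue_on {0..t}) (f n) \<and> f n ` {0..t} \<subseteq> vcarrier V) \<and>
           (AE s in lebesgue_on {0..t}. (\<lambda>n. vdist V (f n s) (u s)) \<longlonglongrightarrow> 0)) \<and>
        integrable (lebesgue_on {0..t}) (\<lambda>s. vnorm V (u s) powr p)}"

definition Lp_norm :: "'v normed_space \<Rightarrow> real \<Rightarrow> real \<Rightarrow> (real \<Rightarrow> 'v) \<Rightarrow> real"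
  where "Lp_norm V p t u =
    (integral\<^sup>L (lebesgue_on {0..t}) (\<lambda>s. vnorm V (u s) powr p)) powr (1 / p)"

subsection \<open>Admissibility and the Weiss property\<close>

lemma has_integral_simple_bochner:
  fixes g :: "real \<Rightarrow> 'y::banach"
  assumes g: "simple_function (lebesgue_on {a..b}) g"
  shows "(g has_integral Bochner_Integration.simple_bochner_integral (lebesgue_on {a..b}) g) {a..b}"
proof -
  let ?E = "\<lambda>y. {s \<in> {a..b}. g s = y}"
  have fin: "finite (g ` {a..b})"
    using g by (simp add: simple_function_def)
  have E: "((\<lambda>s. indicat_real (?E y) s *\<^sub>R y) has_integral
      measure (lebesgue_on {a..b}) (?E y) *\<^sub>R y) {a..b}" if "y \<in> g ` {a..b}" for y
  proof -
    have eq: "?E y = g -` {y} \<inter> {a..b}"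
      by auto
    have "?E y \<in> sets (lebesgue_on {a..b})"
      using g that unfolding eq by (auto simp: simple_function_def)
    then have "?E y \<in> sets lebesgue"
      by (auto simp: sets_restrict_space_iff)
    then have lm: "?E y \<in> lmeasurable"
      by (rule bounded_set_imp_lmeasurable[rotated]) (auto intro: bounded_subset[of "{a..b}"])
    then have "(indicat_real (?E y) has_integral measure lebesgue (?E y)) UNIV"
      using lmeasurable_iff_has_integral by blast
    moreover have "indicat_real (?E y) = (\<lambda>s. if s \<in> {a..b} then indicat_real (?E y) s else 0)"
      by (auto simp: indicator_def)
    ultimately have "((\<lambda>s. if s \<in> {a..b} then indicat_real (?E y) s else 0) has_integral
        measure lebesgue (?E y)) UNIV"
      by simp
    then have "(indicat_real (?E y) has_integral measure lebesgue (?E y)) {a..b}"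
      by (simp only: has_integral_restrict_UNIV)
    moreover have "measure (lebesgue_on {a..b}) (?E y) = measure lebesgue (?E y)"
      by (rule measure_restrict_space) auto
    ultimately show ?thesis
      by (simp add: has_integral_scaleR_left)
  qed
  have "((\<lambda>s. \<Sum>y\<in>g ` {a..b}. indicat_real (?E y) s *\<^sub>R y) has_integral
      Bochner_Integration.simple_bochner_integral (lebesgue_on {a..b}) g) {a..b}"
    using has_integral_sum[where f = "\<lambda>y s. indicat_real (?E y) s *\<^sub>R y", OF fin E]
    by (simp add: simple_bochner_integral_def)
  moreover have "(\<Sum>y\<in>g ` {a..b}. indicat_real (?E y) s *\<^sub>R y) = g s" if "s \<in> {a..b}" for s
  proof -
    have "(\<Sum>y\<in>g ` {a..b}. indicat_real (?E y) s *\<^sub>R y) =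
        (\<Sum>y\<in>g ` {a..b}. if y = g s then y else 0)"
      using that by (intro sum.cong) (auto simp: indicator_def)
    then show ?thesis
      using fin that by (simp add: sum.delta)
  qed
  ultimately show ?thesis
    by (rule has_integral_eq[rotated])
qed

text \<open>
  The Bochner integral of the library is confined to second countable codomains. The gauge integral
  is available for all Banach spaces, and agrees with the Bochner integral whenever the latter exists.
\<close>

lemma has_integral_bochner:
  fixes f :: "real \<Rightarrow> 'y::banach"
  assumes g: "\<And>n. simple_function (lebesgue_on {a..b}) (g n)"
    and int: "\<And>n. integrable (lebesgue_on {a..b}) (\<lambda>s. norm (f s - g n s))"
    and lim: "(\<lambda>n. integral\<^sup>L (lebesgue_on {a..b}) (\<lambda>s. norm (f s - g n s))) \<longlonglongrightarrow> 0"
  shows "f integrable_on {a..b}"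
    and "(\<lambda>n. Bochner_Integration.simple_bochner_integral (lebesgue_on {a..b}) (g n))
      \<longlonglongrightarrow> integral {a..b} f"
proof -
  define I where "I n = Bochner_Integration.simple_bochner_integral (lebesgue_on {a..b}) (g n)" for n
  define h where "h n s = norm (f s - g n s)" for n s
  define H where "H n = integral\<^sup>L (lebesgue_on {a..b}) (h n)" for n
  have gI: "(g n has_integral I n) {a..b}" for n
    unfolding I_def by (rule has_integral_simple_bochner[OF g])
  have hH: "(h n has_integral H n) {a..b}" for n
    unfolding H_def using int[of n] unfolding h_def
    by (intro has_integral_integral_lebesgue_on) auto
  have H0: "H \<longlonglongrightarrow> 0"
    using lim unfolding H_def h_def .
  have diff: "norm (I m - I n) \<le> H m + H n" for m n
  proof -
    have gd: "((\<lambda>s. g m s - g n s) has_integral (I m - I n)) {a..b}"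
      by (intro has_integral_diff gI)
    have hs: "((\<lambda>s. h m s + h n s) has_integral (H m + H n)) {a..b}"
      by (intro has_integral_add hH)
    have "norm (g m s - g n s) \<le> h m s + h n s" for s
    proof -
      have "norm (g m s - g n s) = norm ((f s - g n s) - (f s - g m s))"
        by simp
      also have "\<dots> \<le> norm (f s - g n s) + norm (f s - g m s)"
        by (rule norm_triangle_ineq4)
      finally show ?thesis
        unfolding h_def by simp
    qed
    then have "norm (integral {a..b} (\<lambda>s. g m s - g n s)) \<le> integral {a..b} (\<lambda>s. h m s + h n s)"
      using gd hs by (intro integral_norm_bound_integral) auto
    then show ?thesis
      using gd hs by (simp add: integral_unique)
  qed
  have "Cauchy I"
  proof (rule metric_CauchyI)
    fix e :: real assume "e > 0"
    then have "\<forall>\<^sub>F n in sequentially. H n < e / 2"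
      by (intro order_tendstoD(2)[OF H0]) simp
    then obtain N where N: "\<And>n. n \<ge> N \<Longrightarrow> H n < e / 2"
      unfolding eventually_sequentially by blast
    have "dist (I m) (I n) < e" if "m \<ge> N" "n \<ge> N" for m n
      using N[OF that(1)] N[OF that(2)] diff[of m n] by (simp add: dist_norm)
    then show "\<exists>N. \<forall>m\<ge>N. \<forall>n\<ge>N. dist (I m) (I n) < e"
      by blast
  qed
  then obtain J where J: "I \<longlonglongrightarrow> J"
    using Cauchy_convergent convergent_def by blast
  have "(f has_integral J) {a..b}"
    unfolding has_integral_real
  proof (intro allI impI)
    fix e :: real assume e: "e > 0"
    have "\<forall>\<^sub>F n in sequentially. H n < e / 5 \<and> dist (I n) J < e / 5"
      using e by (intro eventually_conj order_tendstoD(2)[OF H0] tendstoD[OF J]) auto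
    then obtain n where n: "H n < e / 5" "dist (I n) J < e / 5"
      unfolding eventually_sequentially by blast
    have e5: "e / 5 > 0"
      using e by simp
    obtain d1 where d1: "gauge d1" "\<And>\<D>. \<D> tagged_division_of {a..b} \<Longrightarrow> d1 fine \<D> \<Longrightarrow>
        norm ((\<Sum>(x, k)\<in>\<D>. measure lborel k *\<^sub>R g n x) - I n) < e / 5"
      using gI[of n, unfolded has_integral_real, rule_format, OF e5]
      by (elim exE conjE) (rule that, assumption, simp)
    obtain d2 where d2: "gauge d2" "\<And>\<D>. \<D> tagged_division_of {a..b} \<Longrightarrow> d2 fine \<D> \<Longrightarrow>
        norm ((\<Sum>(x, k)\<in>\<D>. measure lborel k *\<^sub>R h n x) - H n) < e / 5"
      using hH[of n, unfolded has_integral_real, rule_format, OF e5]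
      by (elim exE conjE) (rule that, assumption, simp)
    show "\<exists>\<gamma>. gauge \<gamma> \<and> (\<forall>\<D>. \<D> tagged_division_of {a..b} \<and> \<gamma> fine \<D> \<longrightarrow>
        norm ((\<Sum>(x, k)\<in>\<D>. measure lborel k *\<^sub>R f x) - J) < e)"
    proof (intro exI conjI allI impI)
      show "gauge (\<lambda>x. d1 x \<inter> d2 x)"
        using d1(1) d2(1) by (rule gauge_Int)
      fix \<D> assume D: "\<D> tagged_division_of {a..b} \<and> (\<lambda>x. d1 x \<inter> d2 x) fine \<D>"
      define F G K where "F = (\<Sum>(x, k)\<in>\<D>. measure lborel k *\<^sub>R f x)"
        and "G = (\<Sum>(x, k)\<in>\<D>. measure lborel k *\<^sub>R g n x)"
        and "K = (\<Sum>(x, k)\<in>\<D>. measure lborel k *\<^sub>R h n x)"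
      have G: "norm (G - I n) < e / 5" and K: "norm (K - H n) < e / 5"
        using d1(2) d2(2) D unfolding fine_Int G_def K_def by blast+
      have "F - G = (\<Sum>(x, k)\<in>\<D>. measure lborel k *\<^sub>R (f x - g n x))"
        unfolding F_def G_def by (simp add: sum_subtractf case_prod_unfold scaleR_diff_right)
      also have "norm \<dots> \<le> K"
        unfolding K_def h_def by (rule sum_norm_le) (auto split: prod.splits)
      finally have FG: "norm (F - G) \<le> K" .
      have "norm (F - J) \<le> norm (F - G) + norm (G - I n) + norm (I n - J)"
        using norm_triangle_ineq[of "F - G" "G - J"] norm_triangle_ineq[of "G - I n" "I n - J"]
        by simp
      then have "norm (F - J) < e"
        using FG G K n unfolding dist_norm real_norm_def by linarith
      then show "norm ((\<Sum>(x, k)\<in>\<D>. measure lborel k *\<^sub>R f x) - J) < e"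
        unfolding F_def .
    qed
  qed
  note fJ = this
  show "f integrable_on {a..b}"
    using fJ by (rule has_integral_integrable)
  show "(\<lambda>n. Bochner_Integration.simple_bochner_integral (lebesgue_on {a..b}) (g n))
      \<longlonglongrightarrow> integral {a..b} f"
    using J unfolding I_def integral_unique[OF fJ] .
qed

definition input_map ::
    "(real \<Rightarrow> 'x \<Rightarrow> 'x) \<Rightarrow> ('x::complex_banach \<Rightarrow> 'y::complex_banach) \<Rightarrow> ('v \<Rightarrow> 'y)
      \<Rightarrow> real \<Rightarrow> (real \<Rightarrow> 'v) \<Rightarrow> 'y"
  where "input_map T j B t u =
    integral {0..t} (\<lambda>s. semigroup_ext T j (t - s) (B (u s)))"

definition admissible ::
    "real \<Rightarrow> (real \<Rightarrow> 'x \<Rightarrow> 'x) \<Rightarrow> ('x::complex_banach \<Rightarrow> 'y::complex_banach)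
      \<Rightarrow> 'v normed_space \<Rightarrow> ('v \<Rightarrow> 'y) \<Rightarrow> bool"
  where "admissible p T j V B \<longleftrightarrow>
    (\<forall>t\<ge>0. \<forall>u\<in>Lp_space V p t. input_map T j B t u \<in> range j) \<and>
    (\<exists>C>0. \<forall>t\<ge>0. \<forall>u\<in>Lp_space V p t.
       X_norm j (input_map T j B t u) \<le> C * Lp_norm V p t u)"

definition element_op :: "'y::complex_banach \<Rightarrow> complex \<Rightarrow> 'y"
  where "element_op b = (\<lambda>z. z *\<^sub>C b)"

definition admissible_element ::
    "real \<Rightarrow> (real \<Rightarrow> 'x \<Rightarrow> 'x) \<Rightarrow> ('x::complex_banach \<Rightarrow> 'y::complex_banach) \<Rightarrow> 'y \<Rightarrow> bool"
  where "admissible_element p T j b \<longleftrightarrow>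
    admissible p T j (type_space :: complex normed_space) (element_op b)"

definition admissibility_constant ::
    "real \<Rightarrow> (real \<Rightarrow> 'x \<Rightarrow> 'x) \<Rightarrow> ('x::complex_banach \<Rightarrow> 'y::complex_banach) \<Rightarrow> 'y \<Rightarrow> real"
  where "admissibility_constant p T j b =
    Inf {C. C > 0 \<and>
      (\<forall>t>0. \<forall>v\<in>Lp_space (type_space :: complex normed_space) p t.
         X_norm j (input_map T j (element_op b) t v) \<le> C * Lp_norm type_space p t v)}"

definition resolvent_condition ::
    "real \<Rightarrow> 'x set \<Rightarrow> ('x \<Rightarrow> 'x) \<Rightarrow> ('x::complex_banach \<Rightarrow> 'y::complex_banach)
      \<Rightarrow> 'v normed_space \<Rightarrow> ('v \<Rightarrow> 'y) \<Rightarrow> bool"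
  where "resolvent_condition p D A j V B \<longleftrightarrow>
    {l. Re l > 0} \<subseteq> resolvent_set D A \<and>
    bdd_above ((\<lambda>l. Re l powr (1 / p) * op_norm V (\<lambda>v. resolvent_ext D A j l (B v)))
      ` {l. Re l > 0})"

text \<open>The type argument is the universe from which the carriers of the Banach spaces \<open>V\<close> are taken.\<close>

definition weiss_property ::
    "'v itself \<Rightarrow> real \<Rightarrow> 'x set \<Rightarrow> ('x \<Rightarrow> 'x) \<Rightarrow> (real \<Rightarrow> 'x \<Rightarrow> 'x)
      \<Rightarrow> ('x::complex_banach \<Rightarrow> 'y::complex_banach) \<Rightarrow> bool"
  where "weiss_property _ p D A T j \<longleftrightarrow>
    (\<forall>(V :: 'v normed_space) B. complex_banach_space V \<longrightarrow> bounded_op V B \<longrightarrow>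
       (admissible p T j V B \<longleftrightarrow> resolvent_condition p D A j V B))"

end

theory Submission
  imports Defs
begin

text \<open>
  If \<open>B\<close> is admissible, then inputs of the form \<open>v(s) u\<close> with \<open>v\<close> scalar show that every \<open>B u\<close> is
  admissible with the same constant. Conversely, exponential inputs turn the admissibility of
  \<open>b = B u\<close> with constant \<open>C\<close> into \<open>norm (R(\<lambda>,A) b) \<le> C (q Re \<lambda>)\<^bsup>-1/q\<^esup>\<close>. A bound on \<open>C\<close> that is
  uniform over unit vectors \<open>u\<close> is therefore a bound on the operator norm of \<open>R(\<lambda>,A) B\<close>, which is
  the resolvent condition for \<open>B\<close>, and the Weiss property gives admissibility.
\<close>

text \<open>The input integral is formed in X_{-1}, whereas the estimate is one in X. A primitive
  links the two: for y0 = R(\<lambda>,A) b, an element of X, the map r |-> e^(-\<lambda> r) T(r) y0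
  is differentiable in X_{-1} and its derivative is minus the integrand, so the integral is a
  difference of two points of X. Differentiability in X_{-1} is read off in X: the extended R(s,A)
  is an isometry into X that intertwines the two semigroups and maps y0 into the domain of A, so
  only the orbit of a domain vector has to be differentiated. The number (q Re \<lambda>)^(-1/q) is
  the L^q norm of e^(-\<lambda> r) on the half line. The weight (Re \<lambda>)^(1/q) cancels its
  dependence on \<lambda> and leaves q^(-1/q). Condition (b) says nothing about the spectrum, so the
  existence of R(\<lambda>,A) on the right half plane must itself be extracted from the Weiss
  property.\<close>

lemma bounded_clinear_imp_bounded_linear:
  assumes "bounded_clinear f"
  shows "bounded_linear f"
proof -
  from assms obtain K where "\<forall>x. norm (f x) \<le> K * norm x" and "clinear f"
    unfolding bounded_clinear_def by blast
  then show ?thesis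
    by (intro bounded_linear_intro[of f K]) (auto simp: clinear_def scaleR_scaleC mult.commute)
qed

lemma bounded_clinear_scaleC: "bounded_clinear f \<Longrightarrow> f (c *\<^sub>C x) = c *\<^sub>C f x"
  by (simp add: bounded_clinear_def clinear_def)

lemma bounded_clinear_comp:
  assumes "bounded_clinear f" "bounded_clinear g"
  shows "bounded_clinear (\<lambda>x. f (g x))"
proof -
  have "bounded_linear (\<lambda>x. f (g x))"
    using assms by (intro bounded_linear_compose[of f g] bounded_clinear_imp_bounded_linear)
  then obtain K where "\<forall>x. norm (f (g x)) \<le> norm x * K"
    using bounded_linear.bounded by blast
  then show ?thesis
    using assms unfolding bounded_clinear_def clinear_def by (auto simp: mult.commute)
qed

lemma scaleC_diff_right: "a *\<^sub>C (x - y) = a *\<^sub>C x - a *\<^sub>C (y :: 'a::complex_normed_vector)"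
  using scaleC_add_right[of a "x - y" y] by simp

lemma scaleC_diff_left: "(a - b) *\<^sub>C x = a *\<^sub>C x - b *\<^sub>C (x :: 'a::complex_normed_vector)"
  using scaleC_add_left[of "a - b" b x] by simp

lemma scaleC_zero_right [simp]: "a *\<^sub>C (0 :: 'a::complex_normed_vector) = 0"
  using scaleC_diff_right[of a 0 "0::'a"] by simp

lemma scaleC_zero_left [simp]: "0 *\<^sub>C x = (0 :: 'a::complex_normed_vector)"
  using scaleC_diff_left[of 0 0 x] by simp

text \<open>Real bilinearity suffices to inherit the limit rules and the product rule for complex
  scaling; the latter differentiates e^(-\<lambda> r) T(r) w.\<close>

lemma bounded_bilinear_scaleC:
  "bounded_bilinear (scaleC :: complex \<Rightarrow> 'a \<Rightarrow> 'a::complex_normed_vector)"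
proof
  fix r a and x :: 'a
  show "(r *\<^sub>R a) *\<^sub>C x = r *\<^sub>R a *\<^sub>C x"
    by (simp add: scaleR_scaleC[of r "a *\<^sub>C x"] scaleC_scaleC scaleR_conv_of_real)
  show "a *\<^sub>C r *\<^sub>R x = r *\<^sub>R a *\<^sub>C x"
    by (simp add: scaleR_scaleC scaleC_scaleC mult.commute)
  show "\<exists>K. \<forall>a (x::'a). norm (a *\<^sub>C x) \<le> norm a * norm x * K"
    by (rule exI[of _ 1]) (simp add: norm_scaleC)
qed (simp_all add: scaleC_add_left scaleC_add_right)

lemmas tendsto_scaleC [tendsto_intros] = bounded_bilinear.tendsto[OF bounded_bilinear_scaleC]
lemmas bounded_linear_scaleC_right = bounded_bilinear.bounded_linear_right[OF bounded_bilinear_scaleC]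

lemma eventually_at_right_pos: "(\<And>h. h > 0 \<Longrightarrow> P h) \<Longrightarrow> \<forall>\<^sub>F h in at_right (0::real). P h"
  unfolding eventually_at_right_field by (auto intro: exI[of _ 1])

subsection \<open>Local boundedness of semigroups\<close>

text \<open>Baire category applied to the closed sets of vectors whose orbit is bounded by \<open>k + 1\<close>
  on \<open>[0, 1 / (k + 1)]\<close>.\<close>

lemma c0_semigroup_locally_bounded:
  fixes T :: "real \<Rightarrow> 'x::complex_banach \<Rightarrow> 'x"
  assumes "c0_semigroup T"
  obtains d M where "d > 0" "\<And>t x. \<lbrakk>0 \<le> t; t \<le> d\<rbrakk> \<Longrightarrow> norm (T t x) \<le> M * norm x"
proof -
  have bl: "bounded_linear (T t)" if "t \<ge> 0" for t
    using assms that bounded_clinear_imp_bounded_linear unfolding c0_semigroup_def by blast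
  have T0: "T 0 x = x" for x
    using assms unfolding c0_semigroup_def by blast
  have lim: "((\<lambda>t. T t x) \<longlongrightarrow> x) (at_right 0)" for x
    using assms unfolding c0_semigroup_def by blast
  define F where "F k = {x. \<forall>t\<in>{0..1 / Suc k}. norm (T t x) \<le> Suc k}" for k :: nat
  have closed_F: "closed (F k)" for k
  proof -
    have "F k = (\<Inter>t\<in>{0..1 / Suc k}. {x. norm (T t x) \<le> Suc k})"
      unfolding F_def by blast
    moreover have "closed {x. norm (T t x) \<le> Suc k}" if "t \<in> {0..1 / Suc k}" for t
      using that bl[of t]
      by (intro closed_Collect_le continuous_intros) (auto intro: linear_continuous_on)
    ultimately show ?thesis
      by auto
  qed
  have cover: "(\<Union>k. F k) = UNIV"
  proof -
    have "\<exists>k. x \<in> F k" for x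
    proof -
      have "\<forall>\<^sub>F t in at_right 0. dist (T t x) x < 1"
        by (rule tendstoD[OF lim]) simp
      then obtain d where d: "d > 0" "\<And>t. 0 < t \<Longrightarrow> t < d \<Longrightarrow> dist (T t x) x < 1"
        unfolding eventually_at_right_field by blast
      \<comment> \<open>One \<open>k\<close> serves two purposes: it shortens the time interval
        below \<open>d\<close> and dominates the bound \<open>norm x + 1\<close> valid
        there.\<close>
      obtain k :: nat where k: "max (1 / d) (norm x + 1) < k"
        using reals_Archimedean2 by blast
      have kd: "1 / Suc k < d"
        using k d(1) by (simp add: field_simps)
      have "norm (T t x) \<le> Suc k" if "t \<in> {0..1 / Suc k}" for t
      proof (cases "t = 0")
        case True
        then show ?thesis
          using T0[of x] k by simp
      next
        case False
        then have "dist (T t x) x < 1"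
          using that kd by (intro d(2)) auto
        then show ?thesis
          using k norm_triangle_ineq[of "T t x - x" x] by (simp add: dist_norm)
      qed
      then show ?thesis
        unfolding F_def by blast
    qed
    then show ?thesis
      by blast
  qed
  have "\<exists>k. interior (F k) \<noteq> {}"
  proof (rule ccontr)
    assume "\<nexists>k. interior (F k) \<noteq> {}"
    then have "euclidean interior_of \<Union>(range F) = {}"
      by (intro Baire_category_alt) (auto simp: completely_metrizable_space_euclidean closed_F)
    then show False
      using cover by simp
  qed
  then obtain k x0 where "x0 \<in> interior (F k)"
    by blast
  then obtain r where r: "r > 0" "cball x0 r \<subseteq> F k"
    unfolding mem_interior_cball by blast
  show thesis
  proof (rule that[of "1 / Suc k" "2 * Suc k / r"])
    fix t :: real and x
    assume t: "0 \<le> t" "t \<le> 1 / Suc k"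
    interpret Tt: bounded_linear "T t"
      using bl t(1) .
    show "norm (T t x) \<le> 2 * Suc k / r * norm x"
    proof (cases "x = 0")
      case True
      then show ?thesis
        by (simp add: Tt.zero)
    next
      case False
      \<comment> \<open>Rescaling to norm \<open>r\<close> keeps \<open>x0 + y\<close> in the ball.
        As \<open>T t y\<close> is a difference of two vectors of norm at most \<open>Suc k\<close>,
        the factor 2 appears, and undoing the rescaling gives the division by
        \<open>r\<close>.\<close>
      define y where "y = (r / norm x) *\<^sub>R x"
      have "norm y = r"
        using False r(1) by (simp add: y_def)
      then have "x0 + y \<in> F k" "x0 \<in> F k"
        using r by (auto simp: subset_iff dist_norm)
      then have "norm (T t (x0 + y)) \<le> Suc k" "norm (T t x0) \<le> Suc k"
        using t unfolding F_def by auto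
      then have "norm (T t y) \<le> 2 * Suc k"
        using norm_triangle_ineq4[of "T t (x0 + y)" "T t x0"] by (simp add: Tt.add)
      moreover have "norm (T t y) = r / norm x * norm (T t x)"
        using r(1) by (simp add: y_def Tt.scaleR)
      ultimately show ?thesis
        using r(1) False by (simp add: field_simps)
    qed
  qed simp
qed

subsection \<open>Extension from a dense subspace\<close>

lemma continuous_agree_on_closure:
  fixes f g :: "'a::topological_space \<Rightarrow> 'b::real_normed_vector"
  assumes "continuous_on (closure S) f" "continuous_on (closure S) g"
    and "\<And>x. x \<in> S \<Longrightarrow> f x = g x" "x \<in> closure S"
  shows "f x = g x"
  using continuous_constant_on_closure[of S "\<lambda>x. f x - g x" 0 x] assms
  by (auto intro: continuous_intros)

text \<open>Uniqueness makes the definite description in \<open>extension\<close> meaningful.\<close>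

lemma bounded_clinear_eq_on_dense_range:
  assumes "closure (range j) = UNIV" "bounded_clinear g" "bounded_clinear h"
    and "\<And>x. g (j x) = h (j x)"
  shows "g y = h y"
proof (rule continuous_agree_on_closure[of "range j" g h])
  show "continuous_on (closure (range j)) g" "continuous_on (closure (range j)) h"
    using assms(2,3) by (auto intro!: linear_continuous_on bounded_clinear_imp_bounded_linear)
qed (use assms in auto)

text \<open>The bound is in terms of \<open>norm (j x)\<close>, not \<open>norm x\<close>: this
  makes \<open>f\<close> factor through \<open>j\<close> as a Lipschitz map on a dense subspace,
  which extends continuously. Linearity then passes to the closure.\<close>

lemma extension_from_dense_range:
  fixes j :: "'x::complex_banach \<Rightarrow> 'y::complex_banach" and f :: "'x \<Rightarrow> 'z::complex_banach"
  assumes j: "clinear j" and dense: "closure (range j) = UNIV"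
    and f: "clinear f" and bound: "\<And>x. norm (f x) \<le> K * norm (j x)"
  shows "bounded_clinear (extension j f)" and "extension j f (j x) = f x"
proof -
  have jd: "j (x - y) = j x - j y" for x y
    using j unfolding clinear_def by (metis add_diff_cancel_right' diff_add_cancel)
  have fd: "f (x - y) = f x - f y" for x y
    using f unfolding clinear_def by (metis add_diff_cancel_right' diff_add_cancel)
  \<comment> \<open>The bound alone makes \<open>f\<close> constant on the fibres of
    \<open>j\<close>, so injectivity of \<open>j\<close> is not assumed.\<close>
  have wd: "f x = f y" if "j x = j y" for x y
    using bound[of "x - y"] that by (simp add: jd fd)
  define h where "h y = f (inv j y)" for y
  have hj: "h (j x) = f x" for x
    unfolding h_def by (rule wd) (simp add: f_inv_into_f)
  have "uniformly_continuous_on (range j) h"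
  proof (rule lipschitz_on_uniformly_continuous)
    \<comment> \<open>A Lipschitz constant must be nonnegative, while the sign of \<open>K\<close>
      is unknown.\<close>
    show "(max K 0)-lipschitz_on (range j) h"
    proof (rule lipschitz_onI)
      fix x y assume "x \<in> range j" "y \<in> range j"
      then obtain a b where ab: "x = j a" "y = j b"
        by blast
      have "dist (h x) (h y) \<le> K * dist x y"
        using bound[of "a - b"] by (simp add: ab hj dist_norm jd fd)
      also have "\<dots> \<le> max K 0 * dist x y"
        by (intro mult_right_mono) auto
      finally show "dist (h x) (h y) \<le> max K 0 * dist x y" .
    qed simp
  qed
  then obtain g where g: "uniformly_continuous_on (closure (range j)) g"
      "\<And>x. x \<in> range j \<Longrightarrow> h x = g x"
    by (rule uniformly_continuous_on_extension_on_closure) blast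
  have gj: "g (j x) = f x" for x
    using g(2)[of "j x"] hj by simp
  have cg: "continuous_on UNIV g"
    using g(1) dense uniformly_continuous_imp_continuous by auto
  have cg': "continuous_on S (\<lambda>x. g (k x))" if "continuous_on S k" for S and k :: "'c::topological_space \<Rightarrow> 'y"
    using continuous_on_compose2[OF cg that] by simp
  have UNIV_range: "closure (range j \<times> range j) = UNIV"
    using dense by (simp add: closure_Times)
  have add: "g (x + y) = g x + g y" for x y
  proof -
    \<comment> \<open>Additivity is treated as one identity between continuous functions on the
      product space, where pairs from \<open>range j\<close> are dense.\<close>
    have "g (fst p + snd p) = g (fst p) + g (snd p)" if "p \<in> closure (range j \<times> range j)" for p
    proof (rule continuous_agree_on_closure[OF _ _ _ that])
      show "continuous_on (closure (range j \<times> range j)) (\<lambda>p. g (fst p + snd p))"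
        "continuous_on (closure (range j \<times> range j)) (\<lambda>p. g (fst p) + g (snd p))"
        by (intro continuous_intros cg')+
    next
      fix p assume "p \<in> range j \<times> range j"
      then obtain a b where "p = (j a, j b)"
        by blast
      moreover have "j a + j b = j (a + b)" "f (a + b) = f a + f b"
        using j f unfolding clinear_def by auto
      ultimately show "g (fst p + snd p) = g (fst p) + g (snd p)"
        by (simp add: gj)
    qed
    from this[of "(x, y)"] show ?thesis
      by (simp add: UNIV_range)
  qed
  have scale: "g (c *\<^sub>C x) = c *\<^sub>C g x" for c x
  proof (rule continuous_agree_on_closure[of "range j" "\<lambda>x. g (c *\<^sub>C x)" "\<lambda>x. c *\<^sub>C g x"])
    show "continuous_on (closure (range j)) (\<lambda>x. g (c *\<^sub>C x))"
      by (intro cg' linear_continuous_on bounded_linear_scaleC_right)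
    show "continuous_on (closure (range j)) (\<lambda>x. c *\<^sub>C g x)"
      by (rule bounded_linear.continuous_on[OF bounded_linear_scaleC_right])
        (rule continuous_on_subset[OF cg], simp)
  next
    fix y assume "y \<in> range j"
    then obtain a where "y = j a"
      by blast
    moreover have "c *\<^sub>C j a = j (c *\<^sub>C a)" "f (c *\<^sub>C a) = c *\<^sub>C f a"
      using j f unfolding clinear_def by auto
    ultimately show "g (c *\<^sub>C y) = c *\<^sub>C g y"
      by (simp add: gj)
  qed (simp add: dense)
  have gbound: "norm (g x) \<le> K * norm x" for x
  proof (rule continuous_le_on_closure[of "range j" "\<lambda>x. norm (g x) - K * norm x" x 0, simplified])
    show "continuous_on (closure (range j)) (\<lambda>x. norm (g x) - K * norm x)"
      by (intro continuous_intros cg')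
  qed (auto simp: dense gj bound)
  have bg: "bounded_clinear g"
    unfolding bounded_clinear_def clinear_def using add scale gbound by blast
  have "extension j f = g"
    unfolding extension_def
  proof (rule the_equality)
    show "bounded_clinear g \<and> (\<forall>x. g (j x) = f x)"
      using bg gj by blast
    fix g' assume "bounded_clinear g' \<and> (\<forall>x. g' (j x) = f x)"
    then show "g' = g"
      using bounded_clinear_eq_on_dense_range[OF dense _ bg, of g'] gj by (intro ext) auto
  qed
  then show "bounded_clinear (extension j f)" and "extension j f (j x) = f x"
    using bg gj by auto
qed

text \<open>\<open>S\<close> preserves the norm of the remainder F(y) - F(r) - (y - r) d.
  Surjectivity is avoided by assuming the derivative of the image already in the form
  \<open>S d\<close>.\<close>

lemma has_vector_derivative_isometry:
  assumes S: "bounded_linear S" and iso: "\<And>y. norm (S y) = norm y"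
    and "((\<lambda>r. S (F r)) has_vector_derivative S d) (at r within I)"
  shows "(F has_vector_derivative d) (at r within I)"
proof -
  interpret S: bounded_linear S
    by (rule S)
  have "norm (S (F y) - S (F r) - (y - r) *\<^sub>R S d) = norm (F y - F r - (y - r) *\<^sub>R d)" for y
    by (simp only: S.diff[symmetric] S.scaleR[symmetric] iso)
  then show ?thesis
    using assms(3) unfolding has_vector_derivative_def has_derivative_within_alt
    by (simp add: bounded_linear_scaleR_left)
qed

subsection \<open>Input functions and admissibility constants\<close>

text \<open>The cut at \<open>\<tau>\<close> is what later isolates the piece of the primitive
  between t - \<tau> and t. The norm bound depends on \<open>t\<close> and \<open>\<tau>\<close>
  only through t - \<tau>, and is exponentially small in that difference.\<close>

lemma truncated_exponential_Lp:
  assumes q: "q > 0" and l: "Re l > 0" and \<tau>: "0 \<le> \<tau>" "\<tau> \<le> t"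
  defines "v \<equiv> \<lambda>x. if x \<le> \<tau> then exp (- l * of_real (t - x)) else 0"
  shows "v \<in> Lp_space type_space q t"
    and "Lp_norm type_space q t v \<le> (q * Re l) powr (- 1 / q) * exp (- Re l * (t - \<tau>))"
proof -
  define a where "a = q * Re l"
  have a: "a > 0"
    using q l by (simp add: a_def)
  define g where "g x = exp (- a * (t - x))" for x
  have powr: "norm (v x) powr q = (if x \<le> \<tau> then g x else 0)" for x
    using q by (simp add: v_def g_def a_def powr_def norm_exp_eq_Re algebra_simps)
  have "((\<lambda>x. g x) has_integral g \<tau> / a - g 0 / a) {0..\<tau>}"
  proof (rule fundamental_theorem_of_calculus[OF \<tau>(1)])
    fix x
    have "((\<lambda>x. g x / a) has_real_derivative g x) (at x within {0..\<tau>})"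
      unfolding g_def using a by (auto intro!: derivative_eq_intros)
    then show "((\<lambda>x. g x / a) has_vector_derivative g x) (at x within {0..\<tau>})"
      by (simp add: has_real_derivative_iff_has_vector_derivative)
  qed
  then have "((\<lambda>x. if x \<in> {0..\<tau>} then g x else 0) has_integral g \<tau> / a - g 0 / a) {0..t}"
    using \<tau> by (subst has_integral_restrict) auto
  then have int: "((\<lambda>x. norm (v x) powr q) has_integral g \<tau> / a - g 0 / a) {0..t}"
    by (rule has_integral_eq[rotated]) (auto simp: powr)
  have "(\<lambda>x. norm (v x) powr q) absolutely_integrable_on {0..t}"
    by (rule nonnegative_absolutely_integrable_1) (use int in auto)
  then have integrable: "integrable (lebesgue_on {0..t}) (\<lambda>x. norm (v x) powr q)"
    by (rule absolutely_integrable_imp_integrable) simp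
  have "v \<in> borel_measurable borel"
    unfolding v_def by measurable
  then have "v \<in> borel_measurable (lebesgue_on {0..t})"
    by (intro measurable_restrict_space1 measurable_completion) simp
  then obtain F where F: "\<And>i. simple_function (lebesgue_on {0..t}) (F i)"
    "\<And>x. x \<in> space (lebesgue_on {0..t}) \<Longrightarrow> (\<lambda>i. F i x) \<longlonglongrightarrow> v x"
    using borel_measurable_implies_sequence_metric[of v "lebesgue_on {0..t}" 0] by metis
  have dist: "vdist type_space z w = dist z w" for z w :: complex
    by (simp add: vdist_def type_space_def scaleC_minus1 dist_norm)
  have "\<forall>n. simple_function (lebesgue_on {0..t}) (F n) \<and> F n ` {0..t} \<subseteq> vcarrier type_space"
    using F(1) by (simp add: type_space_def)
  moreover have "AE x in lebesgue_on {0..t}. (\<lambda>n. vdist type_space (F n x) (v x)) \<longlonglongrightarrow> 0"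
    using F(2) by (intro AE_I2) (simp add: dist tendsto_dist_iff[symmetric])
  ultimately show "v \<in> Lp_space type_space q t"
    unfolding Lp_space_def using integrable by (auto simp: type_space_def)
  have "integral\<^sup>L (lebesgue_on {0..t}) (\<lambda>x. norm (v x) powr q) = g \<tau> / a - g 0 / a"
    using lebesgue_integral_eq_integral[OF integrable] integral_unique[OF int] by simp
  moreover have "0 \<le> g \<tau> / a - g 0 / a"
    by (rule has_integral_nonneg[OF int]) simp
  moreover have "g \<tau> / a - g 0 / a \<le> g \<tau> / a"
    using a by (simp add: g_def)
  ultimately have "Lp_norm type_space q t v \<le> (g \<tau> / a) powr (1 / q)"
    unfolding Lp_norm_def using q by (auto simp: type_space_def intro!: powr_mono2)
  also have "\<dots> = a powr (- 1 / q) * g \<tau> powr (1 / q)"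
    using a by (simp add: powr_divide powr_minus_divide g_def)
  also have "g \<tau> powr (1 / q) = exp (- Re l * (t - \<tau>))"
    using q by (simp add: g_def a_def powr_def)
  finally show "Lp_norm type_space q t v \<le> (q * Re l) powr (- 1 / q) * exp (- Re l * (t - \<tau>))"
    unfolding a_def .
qed

text \<open>For a unit vector \<open>u\<close>, the map z |-> z u is an isometric embedding of the
  scalars into \<open>U\<close>, so simple approximations and norms carry over unchanged.\<close>

lemma Lp_vscale:
  assumes U: "complex_banach_space U" and u: "u \<in> vcarrier U" "vnorm U u = 1"
    and v: "v \<in> Lp_space (type_space :: complex normed_space) q t"
  shows "(\<lambda>x. vscale U (v x) u) \<in> Lp_space U q t"
    and "Lp_norm U q t (\<lambda>x. vscale U (v x) u) = Lp_norm type_space q t v"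
proof -
  interpret U: complex_banach_space U
    by (rule U)
  have norm: "vnorm U (vscale U z u) = vnorm type_space z" for z
    using u by (simp add: U.norm_scale type_space_def)
  have dist: "vdist U (vscale U z u) (vscale U w u) = vdist type_space z w" for z w
    using u norm[of "z + - w"]
    by (simp add: vdist_def U.scale_scale U.scale_add_left[symmetric] type_space_def scaleC_minus1)
  from v obtain f where f: "\<And>n. simple_function (lebesgue_on {0..t}) (f n)"
      "AE x in lebesgue_on {0..t}. (\<lambda>n. vdist type_space (f n x) (v x)) \<longlonglongrightarrow> 0"
    and int: "integrable (lebesgue_on {0..t}) (\<lambda>x. vnorm type_space (v x) powr q)"
    unfolding Lp_space_def by blast
  have "\<forall>n. simple_function (lebesgue_on {0..t}) (\<lambda>x. vscale U (f n x) u) \<and>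
      (\<lambda>x. vscale U (f n x) u) ` {0..t} \<subseteq> vcarrier U"
    using f(1) u(1) by (auto intro: U.scale_closed simple_function_compose1)
  moreover have "AE x in lebesgue_on {0..t}.
      (\<lambda>n. vdist U (vscale U (f n x) u) (vscale U (v x) u)) \<longlonglongrightarrow> 0"
    using f(2) by (simp add: dist)
  ultimately show "(\<lambda>x. vscale U (v x) u) \<in> Lp_space U q t"
    unfolding Lp_space_def using int u(1)
    by (auto simp: norm U.scale_closed intro!: exI[of _ "\<lambda>n x. vscale U (f n x) u"])
  show "Lp_norm U q t (\<lambda>x. vscale U (v x) u) = Lp_norm type_space q t v"
    by (simp add: Lp_norm_def norm)
qed

lemma admissible_imp_uniformly_admissible_elements:
  assumes U: "complex_banach_space U" and B: "bounded_op U B" and adm: "admissible q T j U B"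
  obtains C where "\<And>u. \<lbrakk>u \<in> vcarrier U; vnorm U u = 1\<rbrakk> \<Longrightarrow>
      admissible_element q T j (B u) \<and> admissibility_constant q T j (B u) \<le> C"
proof -
  from adm obtain C where range: "\<And>t u. \<lbrakk>t \<ge> 0; u \<in> Lp_space U q t\<rbrakk> \<Longrightarrow> input_map T j B t u \<in> range j"
    and C: "C > 0" "\<And>t u. \<lbrakk>t \<ge> 0; u \<in> Lp_space U q t\<rbrakk> \<Longrightarrow>
      X_norm j (input_map T j B t u) \<le> C * Lp_norm U q t u"
    unfolding admissible_def by blast
  show thesis
  proof (rule that, rule conjI)
    fix u assume u: "u \<in> vcarrier U" "vnorm U u = 1"
    have input: "input_map T j (element_op (B u)) t v = input_map T j B t (\<lambda>x. vscale U (v x) u)"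
      for t v
      using B u(1) by (simp add: input_map_def element_op_def bounded_op_def)
    have bound: "X_norm j (input_map T j (element_op (B u)) t v) \<le> C * Lp_norm type_space q t v"
      if "t \<ge> 0" "v \<in> Lp_space type_space q t" for t v
      using C(2)[OF that(1) Lp_vscale(1)[OF U u that(2)]]
      by (simp add: input Lp_vscale(2)[OF U u that(2)])
    show "admissible_element q T j (B u)"
      unfolding admissible_element_def admissible_def
      using range[OF _ Lp_vscale(1)[OF U u]] bound C(1) by (auto simp: input)
    \<comment> \<open>The admissibility constant \<open>C\<close> of \<open>B\<close> does not
      depend on \<open>u\<close> and belongs to the set whose infimum is taken.\<close>
    show "admissibility_constant q T j (B u) \<le> C"
      unfolding admissibility_constant_def
      by (rule cInf_lower) (use C(1) bound in \<open>auto intro: bdd_belowI[of _ 0]\<close>)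
  qed
qed

text \<open>The infimum is attained: for fixed \<open>t\<close> and \<open>v\<close> the inequality
  is a lower bound on the constant, and it survives passage to the infimum. Inputs of norm zero
  cannot be divided by; for them any one admissible constant already gives zero.\<close>

lemma admissibility_constant_bound:
  assumes adm: "admissible_element q T j b" and t: "t > 0"
    and v: "v \<in> Lp_space (type_space :: complex normed_space) q t"
  shows "X_norm j (input_map T j (element_op b) t v) \<le>
    admissibility_constant q T j b * Lp_norm type_space q t v"
proof (cases "Lp_norm type_space q t v = 0")
  case True
  then show ?thesis
    using adm t v unfolding admissible_element_def admissible_def
    by (metis less_eq_real_def mult_zero_right)
next
  case False
  then have pos: "Lp_norm type_space q t v > 0"
    by (simp add: Lp_norm_def less_le)
  have "X_norm j (input_map T j (element_op b) t v) / Lp_norm type_space q t v \<le>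
      admissibility_constant q T j b"
    unfolding admissibility_constant_def
  proof (rule cInf_greatest)
    from adm obtain C where "C > 0" "\<forall>t\<ge>0. \<forall>v\<in>Lp_space type_space q t.
        X_norm j (input_map T j (element_op b) t v) \<le> C * Lp_norm type_space q t v"
      unfolding admissible_element_def admissible_def by blast
    then show "{C. C > 0 \<and> (\<forall>t>0. \<forall>v\<in>Lp_space type_space q t.
        X_norm j (input_map T j (element_op b) t v) \<le> C * Lp_norm type_space q t v)} \<noteq> {}"
      by force
  qed (use pos t v in \<open>auto simp: divide_le_eq\<close>)
  then show ?thesis
    using pos by (simp add: divide_le_eq)
qed

subsection \<open>Semigroups on the extrapolation space\<close>

locale extrapolated_semigroup =
  fixes T :: "real \<Rightarrow> 'x::complex_banach \<Rightarrow> 'x"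
    and D :: "'x set" and A :: "'x \<Rightarrow> 'x"
    and s :: complex and j :: "'x \<Rightarrow> 'y::complex_banach"
  assumes semigroup: "c0_semigroup T"
    and generator: "is_generator D A T"
    and extrapolation: "is_extrapolation_space D A s j"
begin

lemma bounded_clinear_T: "t \<ge> 0 \<Longrightarrow> bounded_clinear (T t)"
  using semigroup unfolding c0_semigroup_def by blast

lemma bounded_linear_T: "t \<ge> 0 \<Longrightarrow> bounded_linear (T t)"
  by (rule bounded_clinear_imp_bounded_linear[OF bounded_clinear_T])

lemma T_0: "T 0 x = x"
  using semigroup unfolding c0_semigroup_def by blast

lemma T_add: "\<lbrakk>r \<ge> 0; t \<ge> 0\<rbrakk> \<Longrightarrow> T (r + t) x = T r (T t x)"
  using semigroup unfolding c0_semigroup_def by blast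

lemma tendsto_T: "((\<lambda>t. T t x) \<longlongrightarrow> x) (at_right 0)"
  using semigroup unfolding c0_semigroup_def by blast

section \<open>The generator as a linear operator commuting with the semigroup\<close>

lemma generator_tendsto:
  "x \<in> D \<Longrightarrow> ((\<lambda>h. (1 / h) *\<^sub>R (T h x - x)) \<longlongrightarrow> A x) (at_right 0)"
  using generator unfolding is_generator_def by blast

text \<open>The domain consists of all vectors with a convergent difference quotient, so a single
  limit yields both membership and value.\<close>

lemma generatorI:
  assumes "((\<lambda>h. (1 / h) *\<^sub>R (T h x - x)) \<longlongrightarrow> y) (at_right 0)"
  shows "x \<in> D" and "A x = y"
proof -
  show "x \<in> D"
    using assms generator unfolding is_generator_def by blast
  then show "A x = y"
    by (intro tendsto_unique[OF _ generator_tendsto assms]) auto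
qed

lemma generator_zero: "0 \<in> D" "A 0 = 0"
proof -
  have "((\<lambda>h. (1 / h) *\<^sub>R (T h 0 - 0)) \<longlongrightarrow> 0) (at_right 0)"
    by (rule tendsto_eventually, rule eventually_at_right_pos)
      (simp add: linear_0[OF bounded_linear.linear[OF bounded_linear_T]])
  then show "0 \<in> D" "A 0 = 0"
    using generatorI by auto
qed

lemma generator_add:
  assumes "x \<in> D" "y \<in> D"
  shows "x + y \<in> D" and "A (x + y) = A x + A y"
proof -
  have "((\<lambda>h. (1 / h) *\<^sub>R (T h (x + y) - (x + y))) \<longlongrightarrow> A x + A y) (at_right 0)"
  proof (rule Lim_transform_eventually)
    show "((\<lambda>h. (1 / h) *\<^sub>R (T h x - x) + (1 / h) *\<^sub>R (T h y - y)) \<longlongrightarrow> A x + A y) (at_right 0)"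
      by (intro tendsto_add generator_tendsto assms)
    show "\<forall>\<^sub>F h in at_right 0. (1 / h) *\<^sub>R (T h x - x) + (1 / h) *\<^sub>R (T h y - y) =
        (1 / h) *\<^sub>R (T h (x + y) - (x + y))"
      by (rule eventually_at_right_pos)
        (simp add: linear_add[OF bounded_linear.linear[OF bounded_linear_T]] algebra_simps)
  qed
  then show "x + y \<in> D" and "A (x + y) = A x + A y"
    using generatorI by auto
qed

lemma generator_scaleC:
  assumes "x \<in> D"
  shows "c *\<^sub>C x \<in> D" and "A (c *\<^sub>C x) = c *\<^sub>C A x"
proof -
  have "((\<lambda>h. (1 / h) *\<^sub>R (T h (c *\<^sub>C x) - c *\<^sub>C x)) \<longlongrightarrow> c *\<^sub>C A x) (at_right 0)"
  proof (rule Lim_transform_eventually)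
    show "((\<lambda>h. c *\<^sub>C (1 / h) *\<^sub>R (T h x - x)) \<longlongrightarrow> c *\<^sub>C A x) (at_right 0)"
      by (intro tendsto_intros generator_tendsto assms)
    show "\<forall>\<^sub>F h in at_right 0. c *\<^sub>C (1 / h) *\<^sub>R (T h x - x) = (1 / h) *\<^sub>R (T h (c *\<^sub>C x) - c *\<^sub>C x)"
      by (rule eventually_at_right_pos)
        (simp add: bounded_clinear_scaleC[OF bounded_clinear_T] scaleC_diff_right[symmetric]
          linear_scale[OF bounded_linear.linear[OF bounded_linear_scaleC_right]])
  qed
  then show "c *\<^sub>C x \<in> D" and "A (c *\<^sub>C x) = c *\<^sub>C A x"
    using generatorI by auto
qed

lemma generator_T:
  assumes "x \<in> D" "t \<ge> 0"
  shows "T t x \<in> D" and "A (T t x) = T t (A x)"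
proof -
  interpret Tt: bounded_linear "T t"
    by (rule bounded_linear_T[OF assms(2)])
  have "((\<lambda>h. (1 / h) *\<^sub>R (T h (T t x) - T t x)) \<longlongrightarrow> T t (A x)) (at_right 0)"
  proof (rule Lim_transform_eventually)
    show "((\<lambda>h. T t ((1 / h) *\<^sub>R (T h x - x))) \<longlongrightarrow> T t (A x)) (at_right 0)"
      by (intro Tt.tendsto generator_tendsto assms)
    show "\<forall>\<^sub>F h in at_right 0. T t ((1 / h) *\<^sub>R (T h x - x)) = (1 / h) *\<^sub>R (T h (T t x) - T t x)"
      using assms(2)
      by (intro eventually_at_right_pos) (simp add: Tt.scaleR Tt.diff T_add[symmetric] add.commute)
  qed
  then show "T t x \<in> D" and "A (T t x) = T t (A x)"
    using generatorI by auto
qed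

section \<open>Resolvents of the generator\<close>

lemma bounded_clinear_resolvent:
  "l \<in> resolvent_set D A \<Longrightarrow> bounded_clinear (resolvent D A l)"
  unfolding resolvent_set_def by blast

lemma resolvent_in_D: "l \<in> resolvent_set D A \<Longrightarrow> resolvent D A l x \<in> D"
  unfolding resolvent_set_def resolvent_def
  by (auto simp: bij_betw_def intro!: inv_into_into)

lemma resolvent_right: "l \<in> resolvent_set D A \<Longrightarrow> l *\<^sub>C resolvent D A l x - A (resolvent D A l x) = x"
  unfolding resolvent_set_def resolvent_def
  by (auto simp: bij_betw_def f_inv_into_f[where f = "\<lambda>x. l *\<^sub>C x - A x"])

lemma resolvent_eqI:
  assumes "l \<in> resolvent_set D A" "z \<in> D" "l *\<^sub>C z - A z = x"
  shows "resolvent D A l x = z"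
  using assms inv_into_f_f[of "\<lambda>x. l *\<^sub>C x - A x" D z]
  unfolding resolvent_set_def resolvent_def bij_betw_def by auto

lemma resolvent_identity:
  assumes l: "l \<in> resolvent_set D A" and m: "m \<in> resolvent_set D A"
  shows "resolvent D A l x =
    resolvent D A m x + (m - l) *\<^sub>C resolvent D A l (resolvent D A m x)"
proof (rule resolvent_eqI[OF l])
  let ?a = "resolvent D A m x"
  let ?b = "resolvent D A l ?a"
  have a: "?a \<in> D" "A ?a = m *\<^sub>C ?a - x"
    using resolvent_in_D[OF m, of x] resolvent_right[OF m, of x] by (auto simp: algebra_simps)
  have b: "?b \<in> D" "A ?b = l *\<^sub>C ?b - ?a"
    using resolvent_in_D[OF l, of ?a] resolvent_right[OF l, of ?a] by (auto simp: algebra_simps)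
  show "?a + (m - l) *\<^sub>C ?b \<in> D"
    by (intro generator_add generator_scaleC a b)
  show "l *\<^sub>C (?a + (m - l) *\<^sub>C ?b) - A (?a + (m - l) *\<^sub>C ?b) = x"
    unfolding generator_add(2)[OF a(1) generator_scaleC(1)[OF b(1)]] generator_scaleC(2)[OF b(1)]
      a(2) b(2)
    by (simp add: scaleC_add_right scaleC_diff_right scaleC_diff_left scaleC_scaleC algebra_simps)
qed

lemma resolvent_T:
  assumes l: "l \<in> resolvent_set D A" and t: "t \<ge> 0"
  shows "resolvent D A l (T t x) = T t (resolvent D A l x)"
proof (rule resolvent_eqI[OF l])
  interpret Tt: bounded_linear "T t"
    by (rule bounded_linear_T[OF t])
  let ?z = "resolvent D A l x"
  have z: "?z \<in> D"
    by (rule resolvent_in_D[OF l])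
  show "T t ?z \<in> D"
    by (rule generator_T[OF z t])
  have "l *\<^sub>C T t ?z - A (T t ?z) = T t (l *\<^sub>C ?z - A ?z)"
    by (simp add: generator_T[OF z t] Tt.diff bounded_clinear_scaleC[OF bounded_clinear_T[OF t]])
  then show "l *\<^sub>C T t ?z - A (T t ?z) = T t x"
    by (simp add: resolvent_right[OF l])
qed

text \<open>The right derivative is the generator limit moved by T(r). On the left the remainder is
  moved by T(r - h), which varies with h, so a bound on these operators uniform in small h is
  required.\<close>

lemma has_vector_derivative_orbit:
  assumes w: "w \<in> D" and r: "r \<ge> 0"
  shows "((\<lambda>r. T r w) has_vector_derivative T r (A w)) (at r within {0..})"
proof -
  interpret Tr: bounded_linear "T r"
    by (rule bounded_linear_T[OF r])
  obtain d M where d: "d > 0" and M: "\<And>t x. \<lbrakk>0 \<le> t; t \<le> d\<rbrakk> \<Longrightarrow> norm (T t x) \<le> M * norm x"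
    using c0_semigroup_locally_bounded[OF semigroup] by metis
  \<comment> \<open>Writing T(r - h) = T(r - d') T(d' - h) separates one fixed bounded operator from
    a factor with time in [0, d], where the local bound \<open>M\<close> applies. The minimum keeps
    r - d' nonnegative.\<close>
  define d' where "d' = min d r"
  have d': "0 \<le> d'" "d' \<le> d" "d' \<le> r"
    using d r by (auto simp: d'_def)
  obtain K where K: "K > 0" "\<And>x. norm (T (r - d') x) \<le> norm x * K"
    using bounded_linear.pos_bounded[OF bounded_linear_T, of "r - d'"] d' by auto
  define N where "N = K * \<bar>M\<bar> + 1"
  have N: "N > 0"
    using K(1) by (simp add: N_def add_nonneg_pos)
  have bound: "norm (T (r - h) x) \<le> N * norm x" if "0 \<le> h" "h \<le> d'" for h x
  proof -
    have "T (r - h) x = T (r - d') (T (d' - h) x)"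
      using T_add[of "r - d'" "d' - h" x] that d' by simp
    then have "norm (T (r - h) x) \<le> norm (T (d' - h) x) * K"
      using K(2) by simp
    also have "\<dots> \<le> (\<bar>M\<bar> * norm x) * K"
    proof (rule mult_right_mono)
      have "norm (T (d' - h) x) \<le> M * norm x"
        using that d' by (intro M) auto
      also have "\<dots> \<le> \<bar>M\<bar> * norm x"
        by (intro mult_right_mono) auto
      finally show "norm (T (d' - h) x) \<le> \<bar>M\<bar> * norm x" .
    qed (use K in simp)
    also have "\<dots> \<le> N * norm x"
      by (simp add: N_def algebra_simps)
    finally show ?thesis .
  qed
  show ?thesis
    unfolding has_vector_derivative_def has_derivative_within_alt
  proof (intro conjI allI impI)
    show "bounded_linear (\<lambda>h. h *\<^sub>R T r (A w))"
      by (rule bounded_linear_scaleR_left)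
    fix E :: real assume "E > 0"
    \<comment> \<open>The left-hand case produces two errors of size \<open>\<epsilon> * h\<close>,
      hence the 2.\<close>
    define \<epsilon> where "\<epsilon> = E / (2 * N)"
    have \<epsilon>: "\<epsilon> > 0" "N * (2 * \<epsilon>) = E"
      using \<open>E > 0\<close> N by (auto simp: \<epsilon>_def)
    have "\<forall>\<^sub>F h in at_right 0. dist ((1 / h) *\<^sub>R (T h w - w)) (A w) < \<epsilon> \<and> dist (T h (A w)) (A w) < \<epsilon>"
      by (intro eventually_conj tendstoD[OF generator_tendsto[OF w]] tendstoD[OF tendsto_T] \<epsilon>)
    then obtain \<eta> where \<eta>: "\<eta> > 0"
      and \<eta>1: "\<And>h. \<lbrakk>0 < h; h < \<eta>\<rbrakk> \<Longrightarrow> dist ((1 / h) *\<^sub>R (T h w - w)) (A w) < \<epsilon>"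
      and \<eta>2: "\<And>h. \<lbrakk>0 < h; h < \<eta>\<rbrakk> \<Longrightarrow> dist (T h (A w)) (A w) < \<epsilon>"
      unfolding eventually_at_right_field by blast
    define e where "e h = T h w - w - h *\<^sub>R A w" for h
    have e: "norm (e h) \<le> \<epsilon> * h" if "0 < h" "h < \<eta>" for h
    proof -
      have "e h = h *\<^sub>R ((1 / h) *\<^sub>R (T h w - w) - A w)"
        using that by (simp add: e_def scaleR_diff_right)
      then have "norm (e h) = h * dist ((1 / h) *\<^sub>R (T h w - w)) (A w)"
        using that by (simp add: dist_norm)
      then show ?thesis
        using \<eta>1[OF that] that by (simp add: mult.commute)
    qed
    show "\<exists>\<delta>>0. \<forall>y\<in>{0..}. norm (y - r) < \<delta> \<longrightarrow>
        norm (T y w - T r w - (y - r) *\<^sub>R T r (A w)) \<le> E * norm (y - r)"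
    proof (intro exI[of _ "min \<eta> d"] conjI ballI impI)
      fix y :: real assume y: "y \<in> {0..}" "norm (y - r) < min \<eta> d"
      consider "y = r" | "y > r" | "y < r"
        by linarith
      then show "norm (T y w - T r w - (y - r) *\<^sub>R T r (A w)) \<le> E * norm (y - r)"
      proof cases
        case 1
        then show ?thesis
          by simp
      next
        case 2
        define h where "h = y - r"
        have h: "0 < h" "h < \<eta>" "y = r + h"
          using 2 y by (auto simp: h_def)
        have "T y w - T r w - (y - r) *\<^sub>R T r (A w) = T r (e h)"
          using h r by (simp add: e_def T_add Tr.diff Tr.scaleR)
        then have "norm (T y w - T r w - (y - r) *\<^sub>R T r (A w)) \<le> N * norm (e h)"
          using bound[of 0 "e h"] d' by simp
        also have "\<dots> \<le> N * (\<epsilon> * h)"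
          using e[OF h(1,2)] N by (intro mult_left_mono) auto
        also have "\<dots> \<le> N * (2 * \<epsilon>) * h"
          using N \<epsilon>(1) h(1) by (simp add: algebra_simps)
        also have "\<dots> = E * norm (y - r)"
          using \<epsilon>(2) h by simp
        finally show ?thesis .
      next
        case 3
        define h where "h = r - y"
        have h: "0 < h" "h < \<eta>" "y = r - h" "h \<le> d'" "h \<le> r"
          using 3 y by (auto simp: h_def d'_def)
        interpret Ty: bounded_linear "T (r - h)"
          using h by (intro bounded_linear_T) simp
        \<comment> \<open>Once T(r - h) is factored out, the remainder is w - T(h) w + h T(h) A w,
          regrouped here into two small terms.\<close>
        define z where "z = h *\<^sub>R (T h (A w) - A w) - e h"
        have split: "T r x = T (r - h) (T h x)" for x
          using T_add[of "r - h" h x] h by simp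
        have "T y w - T r w - (y - r) *\<^sub>R T r (A w) = T (r - h) z"
          unfolding z_def e_def h(3) split by (simp add: Ty.diff Ty.scaleR Ty.add algebra_simps)
        then have "norm (T y w - T r w - (y - r) *\<^sub>R T r (A w)) \<le> N * norm z"
          using bound[of h z] h by simp
        also have "\<dots> \<le> N * (h * \<epsilon> + \<epsilon> * h)"
        proof (rule mult_left_mono)
          have "norm z \<le> norm (h *\<^sub>R (T h (A w) - A w)) + norm (e h)"
            unfolding z_def by (rule norm_triangle_ineq4)
          also have "norm (h *\<^sub>R (T h (A w) - A w)) \<le> h * \<epsilon>"
            using \<eta>2[OF h(1,2)] h(1) by (simp add: dist_norm)
          finally show "norm z \<le> h * \<epsilon> + \<epsilon> * h"
            using e[OF h(1,2)] by linarith
        qed (use N in simp)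
        also have "\<dots> = N * (2 * \<epsilon>) * h"
          by (simp add: algebra_simps)
        also have "\<dots> = E * norm (y - r)"
          using \<epsilon>(2) h by simp
        finally show ?thesis .
      qed
    qed (use \<eta> d in auto)
  qed
qed

section \<open>Extrapolation space and extended operators\<close>

lemma s_resolvent: "s \<in> resolvent_set D A"
  using extrapolation unfolding is_extrapolation_space_def by blast

lemma clinear_j: "clinear j"
  using extrapolation unfolding is_extrapolation_space_def by blast

lemma norm_j: "norm (j x) = norm (resolvent D A s x)"
  using extrapolation unfolding is_extrapolation_space_def by blast

lemma dense_j: "closure (range j) = UNIV"
  using extrapolation unfolding is_extrapolation_space_def by blast

lemma bounded_clinear_j: "bounded_clinear j"
  using clinear_j bounded_clinear_resolvent[OF s_resolvent]
  unfolding bounded_clinear_def by (simp add: norm_j)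

lemma inj_j: "inj j"
proof (rule injI)
  fix x y assume "j x = j y"
  then have "norm (j (x - y)) = 0"
    by (simp add: linear_diff[OF bounded_linear.linear[OF
          bounded_clinear_imp_bounded_linear[OF bounded_clinear_j]]])
  then have "resolvent D A s (x - y) = 0"
    by (simp add: norm_j)
  then show "x = y"
    using resolvent_right[OF s_resolvent, of "x - y"] by (simp add: generator_zero)
qed

lemma X_norm_j: "X_norm j (j x) = norm x"
  by (simp add: X_norm_def inj_j)

text \<open>By the resolvent identity R(\<lambda>,A) x is controlled by R(s,A) x, whose norm is that
  of \<open>j x\<close>. Hence the extension takes values in X itself.\<close>

lemma resolvent_ext:
  assumes l: "l \<in> resolvent_set D A"
  shows "bounded_clinear (resolvent_ext D A j l)" and "resolvent_ext D A j l (j x) = resolvent D A l x"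
proof -
  have cl: "clinear (resolvent D A l)"
    using bounded_clinear_resolvent[OF l] unfolding bounded_clinear_def by blast
  obtain K where K: "\<And>x. norm (resolvent D A l x) \<le> K * norm x"
    using bounded_clinear_resolvent[OF l] unfolding bounded_clinear_def by blast
  have bound: "norm (resolvent D A l x) \<le> (1 + cmod (s - l) * K) * norm (j x)" for x
  proof -
    have "norm (resolvent D A l x) \<le> norm (resolvent D A s x) +
        norm ((s - l) *\<^sub>C resolvent D A l (resolvent D A s x))"
      unfolding resolvent_identity[OF l s_resolvent, of x] by (rule norm_triangle_ineq)
    also have "norm ((s - l) *\<^sub>C resolvent D A l (resolvent D A s x)) \<le>
        cmod (s - l) * (K * norm (resolvent D A s x))"
      unfolding norm_scaleC by (intro mult_left_mono K) simp
    finally show ?thesis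
      by (simp add: norm_j algebra_simps)
  qed
  show "bounded_clinear (resolvent_ext D A j l)" "resolvent_ext D A j l (j x) = resolvent D A l x"
    unfolding resolvent_ext_def
    by (rule extension_from_dense_range[OF clinear_j dense_j cl bound])+
qed

text \<open>T(t) commutes with R(s,A), so a bound for T(t) on X is also one for the norm of
  X_{-1}.\<close>

lemma semigroup_ext:
  assumes t: "t \<ge> 0"
  shows "bounded_clinear (semigroup_ext T j t)" and "semigroup_ext T j t (j x) = j (T t x)"
proof -
  have cl: "clinear (\<lambda>x. j (T t x))"
    using clinear_j bounded_clinear_T[OF t] unfolding bounded_clinear_def clinear_def by simp
  obtain K where K: "\<And>x. norm (T t x) \<le> K * norm x"
    using bounded_clinear_T[OF t] unfolding bounded_clinear_def by blast
  have bound: "norm (j (T t x)) \<le> K * norm (j x)" for x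
    by (simp add: norm_j resolvent_T[OF s_resolvent t] K)
  show "bounded_clinear (semigroup_ext T j t)" "semigroup_ext T j t (j x) = j (T t x)"
    unfolding semigroup_ext_def
    by (rule extension_from_dense_range[OF clinear_j dense_j cl bound])+
qed

abbreviation S where "S \<equiv> resolvent_ext D A j s"

lemma bounded_linear_S: "bounded_linear S"
  by (intro bounded_clinear_imp_bounded_linear resolvent_ext s_resolvent)

lemma norm_S: "norm (S y) = norm y"
proof (rule continuous_agree_on_closure[of "range j" "\<lambda>y. norm (S y)" norm])
  show "continuous_on (closure (range j)) (\<lambda>y. norm (S y))"
    by (rule continuous_on_norm[OF linear_continuous_on[OF bounded_linear_S]])
  show "continuous_on (closure (range j)) (norm :: 'y \<Rightarrow> real)"
    by (rule continuous_on_norm_id)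
qed (auto simp: dense_j norm_j resolvent_ext(2)[OF s_resolvent])

lemma S_semigroup_ext:
  assumes t: "t \<ge> 0"
  shows "S (semigroup_ext T j t y) = T t (S y)"
proof (rule bounded_clinear_eq_on_dense_range[OF dense_j,
      of "\<lambda>y. S (semigroup_ext T j t y)" "\<lambda>y. T t (S y)"])
  show "bounded_clinear (\<lambda>y. S (semigroup_ext T j t y))"
    by (rule bounded_clinear_comp[OF resolvent_ext(1)[OF s_resolvent] semigroup_ext(1)[OF t]])
  show "bounded_clinear (\<lambda>y. T t (S y))"
    by (rule bounded_clinear_comp[OF bounded_clinear_T[OF t] resolvent_ext(1)[OF s_resolvent]])
  show "S (semigroup_ext T j t (j x)) = T t (S (j x))" for x
    by (simp add: resolvent_ext(2)[OF s_resolvent] semigroup_ext(2)[OF t] resolvent_T[OF s_resolvent t])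
qed

text \<open>This is the resolvent identity extended by density. It writes \<open>S b\<close> through
  R(\<lambda>,A) b and a vector in the domain of \<open>A\<close>, which is what the derivative
  formula needs.\<close>

lemma S_eq_resolvent_ext:
  assumes l: "l \<in> resolvent_set D A"
  shows "S y = resolvent_ext D A j l y + (l - s) *\<^sub>C resolvent D A s (resolvent_ext D A j l y)"
proof (rule continuous_agree_on_closure[of "range j" S
      "\<lambda>y. resolvent_ext D A j l y + (l - s) *\<^sub>C resolvent D A s (resolvent_ext D A j l y)"])
  have R: "bounded_linear (resolvent_ext D A j l)" "bounded_linear (resolvent D A s)"
    by (intro bounded_clinear_imp_bounded_linear resolvent_ext(1)[OF l]
        bounded_clinear_resolvent[OF s_resolvent])+
  have "bounded_linear (\<lambda>y. (l - s) *\<^sub>C resolvent D A s (resolvent_ext D A j l y))"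
    by (rule bounded_linear_compose[OF bounded_linear_scaleC_right bounded_linear_compose[OF R(2,1)]])
  then show "continuous_on (closure (range j))
      (\<lambda>y. resolvent_ext D A j l y + (l - s) *\<^sub>C resolvent D A s (resolvent_ext D A j l y))"
    by (intro continuous_on_add linear_continuous_on R(1))
  show "continuous_on (closure (range j)) S"
    by (intro linear_continuous_on bounded_linear_S)
  fix y assume "y \<in> range j"
  then obtain x where x: "y = j x"
    by blast
  show "S y = resolvent_ext D A j l y + (l - s) *\<^sub>C resolvent D A s (resolvent_ext D A j l y)"
    unfolding x resolvent_ext(2)[OF l] resolvent_ext(2)[OF s_resolvent]
    by (rule resolvent_identity[OF s_resolvent l])
qed (simp add: dense_j)

text \<open>Formally this is (A - \<lambda>) R(\<lambda>,A) b = -b in X_{-1}. The vector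
  R(\<lambda>,A) b need not lie in \<open>D\<close>; applying \<open>S\<close> replaces it by w =
  R(s,A) R(\<lambda>,A) b, which does.\<close>

lemma has_vector_derivative_ext_orbit:
  assumes l: "l \<in> resolvent_set D A" and r: "r \<ge> 0"
  shows "((\<lambda>r. exp (- l * of_real r) *\<^sub>C j (T r (resolvent_ext D A j l b))) has_vector_derivative
    - semigroup_ext T j r (exp (- l * of_real r) *\<^sub>C b)) (at r within {0..})"
proof (rule has_vector_derivative_isometry[OF bounded_linear_S norm_S])
  define y0 where "y0 = resolvent_ext D A j l b"
  define w where "w = resolvent D A s y0"
  interpret Tr: bounded_linear "T r"
    by (rule bounded_linear_T[OF r])
  interpret S: bounded_linear S
    by (rule bounded_linear_S)
  have w: "w \<in> D" "A w = s *\<^sub>C w - y0"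
    using resolvent_in_D[OF s_resolvent, of y0] resolvent_right[OF s_resolvent, of y0]
    by (auto simp: w_def algebra_simps)
  have Sb: "S b = y0 + (l - s) *\<^sub>C w"
    unfolding y0_def w_def by (rule S_eq_resolvent_ext[OF l])
  have "((\<lambda>r. exp (- l * of_real r)) has_vector_derivative - l * exp (- l * of_real r))
      (at r within {0..})"
    by (auto intro!: derivative_eq_intros has_vector_derivative_real_field)
  from bounded_bilinear.has_vector_derivative[OF bounded_bilinear_scaleC this
      has_vector_derivative_orbit[OF w(1) r]]
  have "((\<lambda>r. exp (- l * of_real r) *\<^sub>C T r w) has_vector_derivative
      exp (- l * of_real r) *\<^sub>C T r (A w) + (- l * exp (- l * of_real r)) *\<^sub>C T r w)
      (at r within {0..})" .
  moreover have "exp (- l * of_real r) *\<^sub>C T r (A w) + (- l * exp (- l * of_real r)) *\<^sub>C T r w =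
      S (- semigroup_ext T j r (exp (- l * of_real r) *\<^sub>C b))"
  proof -
    \<comment> \<open>The terms in \<open>y0\<close> and in s w cancel, leaving the formal identity
      after application of \<open>S\<close>.\<close>
    have "A w - l *\<^sub>C w = - S b"
      unfolding Sb w(2) by (simp add: scaleC_diff_left)
    then have "T r (A w) - l *\<^sub>C T r w = - T r (S b)"
      by (metis Tr.diff Tr.neg bounded_clinear_scaleC[OF bounded_clinear_T[OF r]])
    then have "exp (- l * of_real r) *\<^sub>C (T r (A w) - l *\<^sub>C T r w) =
        exp (- l * of_real r) *\<^sub>C (- T r (S b))"
      by simp
    moreover have "S (semigroup_ext T j r (exp (- l * of_real r) *\<^sub>C b)) =
        exp (- l * of_real r) *\<^sub>C T r (S b)"
      by (simp only: S_semigroup_ext[OF r] bounded_clinear_scaleC[OF bounded_clinear_T[OF r]]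
          bounded_clinear_scaleC[OF resolvent_ext(1)[OF s_resolvent]])
    ultimately show ?thesis
      using scaleC_diff_left[of 0 "l * exp (- l * of_real r)" "T r w"]
        scaleC_diff_right[of "exp (- l * of_real r)" 0 "T r (S b)"]
      by (simp add: S.neg scaleC_diff_right scaleC_scaleC mult.commute)
  qed
  ultimately have "((\<lambda>r. exp (- l * of_real r) *\<^sub>C T r w) has_vector_derivative
      S (- semigroup_ext T j r (exp (- l * of_real r) *\<^sub>C b))) (at r within {0..})"
    by simp
  then show "((\<lambda>r. S (exp (- l * of_real r) *\<^sub>C j (T r (resolvent_ext D A j l b)))) has_vector_derivative
      S (- semigroup_ext T j r (exp (- l * of_real r) *\<^sub>C b))) (at r within {0..})"
  proof (rule has_vector_derivative_transform[rotated 2])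
    fix x :: real assume "x \<in> {0..}"
    then have "S (j (T x y0)) = T x w"
      by (simp add: resolvent_ext(2)[OF s_resolvent] resolvent_T[OF s_resolvent] w_def)
    then show "S (exp (- l * of_real x) *\<^sub>C j (T x (resolvent_ext D A j l b))) = exp (- l * of_real x) *\<^sub>C T x w"
      unfolding y0_def[symmetric] by (simp only: bounded_clinear_scaleC[OF resolvent_ext(1)[OF s_resolvent]])
  qed (use r in simp)
qed

text \<open>Under the reflection x |-> t - x the integrand has the primitive \<open>j (E r)\<close>.
  The input vanishes after \<open>\<tau>\<close>, so the lower end of the reflected interval is t -
  \<tau>.\<close>

lemma input_map_exponential:
  fixes b :: 'y
  assumes l: "l \<in> resolvent_set D A" and \<tau>: "0 \<le> \<tau>" "\<tau> \<le> t"
  defines "E \<equiv> \<lambda>r. exp (- l * of_real r) *\<^sub>C T r (resolvent_ext D A j l b)"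
  shows "input_map T j (element_op b) t (\<lambda>x. if x \<le> \<tau> then exp (- l * of_real (t - x)) else 0) =
    j (E (t - \<tau>) - E t)"
proof -
  define G where "G r = exp (- l * of_real r) *\<^sub>C j (T r (resolvent_ext D A j l b))" for r
  define g where "g r = semigroup_ext T j r (exp (- l * of_real r) *\<^sub>C b)" for r
  have jE: "j (E r) = G r" for r
    unfolding E_def G_def by (rule bounded_clinear_scaleC[OF bounded_clinear_j])
  have "((\<lambda>x. g (t - x)) has_integral G (t - \<tau>) - G (t - 0)) {0..\<tau>}"
  proof (rule fundamental_theorem_of_calculus[OF \<tau>(1)])
    fix x assume x: "x \<in> {0..\<tau>}"
    have "(G has_vector_derivative - g (t - x)) (at (t - x) within {0..})"
      unfolding G_def g_def using x \<tau> by (intro has_vector_derivative_ext_orbit l) simp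
    then have "(G has_vector_derivative - g (t - x)) (at (t - x) within (\<lambda>x. t - x) ` {0..\<tau>})"
      by (rule has_vector_derivative_within_subset) (use \<tau> in auto)
    moreover have "((\<lambda>x. t - x) has_vector_derivative - 1) (at x within {0..\<tau>})"
      by (auto intro!: derivative_eq_intros)
    ultimately have "((G \<circ> (\<lambda>x. t - x)) has_vector_derivative (- 1) *\<^sub>R (- g (t - x))) (at x within {0..\<tau>})"
      by (intro vector_diff_chain_within)
    then show "((\<lambda>x. G (t - x)) has_vector_derivative g (t - x)) (at x within {0..\<tau>})"
      by (simp add: o_def)
  qed
  then have "((\<lambda>x. if x \<in> {0..\<tau>} then g (t - x) else 0) has_integral G (t - \<tau>) - G t) {0..t}"
    using \<tau> by (subst has_integral_restrict) auto
  then have "((\<lambda>x. semigroup_ext T j (t - x)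
      (element_op b (if x \<le> \<tau> then exp (- l * of_real (t - x)) else 0))) has_integral G (t - \<tau>) - G t) {0..t}"
  proof (rule has_integral_eq[rotated])
    fix x assume "x \<in> {0..t}"
    then show "(if x \<in> {0..\<tau>} then g (t - x) else 0) = semigroup_ext T j (t - x)
        (element_op b (if x \<le> \<tau> then exp (- l * of_real (t - x)) else 0))"
      using linear_0[OF bounded_linear.linear[OF bounded_clinear_imp_bounded_linear[OF
            semigroup_ext(1)[of "t - x"]]]]
      by (auto simp: g_def element_op_def)
  qed
  then show ?thesis
    unfolding input_map_def
    by (simp add: integral_unique jE linear_diff[OF bounded_linear.linear[OF
          bounded_clinear_imp_bounded_linear[OF bounded_clinear_j]]])
qed

lemma exp_invariant_imp_eigenvector:
  assumes "\<And>h. h > 0 \<Longrightarrow> T h y = exp (l * of_real h) *\<^sub>C y"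
  shows "y \<in> D" and "A y = l *\<^sub>C y"
proof -
  have "((\<lambda>z. exp (l * z)) has_field_derivative l) (at 0)"
    by (auto intro!: derivative_eq_intros)
  then have "((\<lambda>z. (exp (l * z) - 1) / z) \<longlongrightarrow> l) (at 0)"
    by (simp add: has_field_derivative_iff)
  moreover have "filterlim (\<lambda>h. complex_of_real h) (at 0) (at_right 0)"
    by (rule filterlim_atI) (auto intro!: tendsto_eq_intros eventually_at_right_pos)
  ultimately have "((\<lambda>h. (exp (l * of_real h) - 1) / of_real h) \<longlongrightarrow> l) (at_right 0)"
    by (rule filterlim_compose)
  then have "((\<lambda>h. ((exp (l * of_real h) - 1) / of_real h) *\<^sub>C y) \<longlongrightarrow> l *\<^sub>C y) (at_right 0)"
    by (intro tendsto_intros)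
  then have "((\<lambda>h. (1 / h) *\<^sub>R (T h y - y)) \<longlongrightarrow> l *\<^sub>C y) (at_right 0)"
    by (rule Lim_transform_eventually)
      (rule eventually_at_right_pos, simp add: assms scaleR_scaleC scaleC_diff_right scaleC_scaleC
        diff_divide_distrib scaleC_diff_left)
  then show "y \<in> D" and "A y = l *\<^sub>C y"
    using generatorI by auto
qed

text \<open>
  With \<open>E r = e\<^bsup>-\<lambda>r\<^esup> T(r) R(\<lambda>,A) b\<close>, feeding truncated exponentials into the input map
  shows that \<open>E\<close> converges in \<open>X\<close>. The limit is fixed by all \<open>e\<^bsup>-\<lambda>h\<^esup> T(h)\<close>, hence an
  eigenvector of \<open>A\<close> for \<open>\<lambda> \<in> \<rho>(A)\<close> or zero. This replaces the Laplace representation of the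
  resolvent, which need not converge absolutely on all of \<open>Re \<lambda> > 0\<close>.
\<close>

lemma resolvent_ext_bound:
  assumes l: "l \<in> resolvent_set D A" "Re l > 0" and q: "q > 0" and C: "C \<ge> 0"
    and bound: "\<And>t v. \<lbrakk>t > 0; v \<in> Lp_space (type_space :: complex normed_space) q t\<rbrakk>
      \<Longrightarrow> X_norm j (input_map T j (element_op b) t v) \<le> C * Lp_norm type_space q t v"
  shows "norm (resolvent_ext D A j l b) \<le> C * (q * Re l) powr (- 1 / q)"
proof -
  define y0 where "y0 = resolvent_ext D A j l b"
  define E where "E r = exp (- l * of_real r) *\<^sub>C T r y0" for r
  define K where "K = C * (q * Re l) powr (- 1 / q)"
  have diff: "norm (E r - E t) \<le> K * exp (- Re l * r)" if "0 \<le> r" "r \<le> t" "t > 0" for r t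
  proof -
    define v where "v x = (if x \<le> t - r then exp (- l * of_real (t - x)) else 0)" for x
    have v: "v \<in> Lp_space type_space q t"
      "Lp_norm type_space q t v \<le> (q * Re l) powr (- 1 / q) * exp (- Re l * (t - (t - r)))"
      unfolding v_def using that by (intro truncated_exponential_Lp l q; simp)+
    have "norm (E r - E t) = X_norm j (input_map T j (element_op b) t v)"
      using input_map_exponential[OF l(1), of "t - r" t b] that
      unfolding v_def by (simp add: X_norm_j E_def y0_def)
    also have "\<dots> \<le> C * Lp_norm type_space q t v"
      by (rule bound[OF that(3) v(1)])
    also have "\<dots> \<le> C * ((q * Re l) powr (- 1 / q) * exp (- Re l * (t - (t - r))))"
      by (rule mult_left_mono[OF v(2) C])
    also have "\<dots> = K * exp (- Re l * r)"
      by (simp add: K_def)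
    finally show ?thesis .
  qed
  have decay: "(\<lambda>n. K * exp (- Re l * real n)) \<longlonglongrightarrow> 0"
  proof -
    have "(\<lambda>n. exp (- Re l) ^ n) \<longlonglongrightarrow> 0"
      using l(2) by (intro LIMSEQ_power_zero) simp
    then have "(\<lambda>n. exp (- Re l * real n)) \<longlonglongrightarrow> 0"
      by (simp add: exp_of_nat_mult[symmetric] mult.commute)
    from tendsto_mult_right_zero[OF this] show ?thesis .
  qed
  have "Cauchy (\<lambda>n. E (real n))"
  proof (rule metric_CauchyI)
    fix e :: real assume "e > 0"
    then obtain N where N: "\<And>n. n \<ge> N \<Longrightarrow> K * exp (- Re l * real n) < e"
      using order_tendstoD(2)[OF decay] unfolding eventually_sequentially by blast
    have *: "dist (E (real m)) (E (real n)) < e" if "m \<ge> N" "m \<le> n" for m n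
    proof (cases "n = 0")
      case True
      then show ?thesis
        using that \<open>e > 0\<close> by simp
    next
      case False
      then show ?thesis
        using diff[of m n] N[of m] that by (simp add: dist_norm)
    qed
    have "dist (E (real m)) (E (real n)) < e" if "m \<ge> N" "n \<ge> N" for m n
      using *[of m n] *[of n m] that by (cases "m \<le> n") (auto simp: dist_commute)
    then show "\<exists>N. \<forall>m\<ge>N. \<forall>n\<ge>N. dist (E (real m)) (E (real n)) < e"
      by blast
  qed
  then obtain y where y: "(\<lambda>n. E (real n)) \<longlonglongrightarrow> y"
    using Cauchy_convergent convergent_def by blast
  have inv: "T h y = exp (l * of_real h) *\<^sub>C y" if h: "h > 0" for h
  proof -
    \<comment> \<open>\<open>E\<close> is an orbit of the rescaled semigroup, so a limit along it
      must be a fixed point.\<close>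
    have shift: "E (real n + h) = exp (- l * of_real h) *\<^sub>C T h (E (real n))" for n
      using h T_add[of h "real n" y0]
      by (simp add: E_def bounded_clinear_scaleC[OF bounded_clinear_T] scaleC_scaleC
          exp_add[symmetric] algebra_simps)
    have "(\<lambda>n. E (real n) - E (real n + h)) \<longlonglongrightarrow> 0"
      by (rule Lim_null_comparison[OF _ decay]) (use diff h in auto)
    from tendsto_diff[OF y this] have "(\<lambda>n. E (real n + h)) \<longlonglongrightarrow> y"
      by simp
    moreover have "(\<lambda>n. E (real n + h)) \<longlonglongrightarrow> exp (- l * of_real h) *\<^sub>C T h y"
      unfolding shift using h
      by (intro tendsto_intros bounded_linear.tendsto[OF bounded_linear_T] y) simp
    ultimately have "y = exp (- l * of_real h) *\<^sub>C T h y"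
      by (rule LIMSEQ_unique)
    then have "exp (l * of_real h) *\<^sub>C y = exp (l * of_real h) *\<^sub>C exp (- l * of_real h) *\<^sub>C T h y"
      by simp
    then show ?thesis
      by (simp add: scaleC_scaleC exp_add[symmetric] scaleC_one)
  qed
  \<comment> \<open>Both \<open>y\<close> and 0 solve (\<lambda> - A) z = 0, hence both equal
    \<open>resolvent D A l 0\<close>.\<close>
  have "y = 0"
    using exp_invariant_imp_eigenvector[OF inv] resolvent_eqI[OF l(1), of y 0]
      resolvent_eqI[OF l(1), of 0 0] by (simp add: generator_zero)
  \<comment> \<open>Here r = 0, where the exponential factor is 1 and E(0) = y0; the successor keeps
    the time positive.\<close>
  have "norm (y0 - E (real (Suc n))) \<le> K" for n
    using diff[of 0 "real (Suc n)"] by (simp add: E_def T_0 scaleC_one)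
  moreover have "(\<lambda>n. norm (y0 - E (real (Suc n)))) \<longlonglongrightarrow> norm (y0 - 0)"
    using LIMSEQ_Suc[OF y] unfolding \<open>y = 0\<close> by (intro tendsto_intros)
  ultimately show ?thesis
    using LIMSEQ_le_const2[of "\<lambda>n. norm (y0 - E (real (Suc n)))" "norm (y0 - 0)" K]
    by (auto simp: y0_def K_def)
qed

lemma admissible_zero: "admissible q T j V (\<lambda>_. 0)"
proof -
  have "input_map T j (\<lambda>_. 0) t u = j 0" if "t \<ge> 0" for t u
  proof -
    have "integral {0..t} (\<lambda>x. semigroup_ext T j (t - x) 0) = integral {0..t} (\<lambda>x. 0 :: 'y)"
      by (rule integral_cong) (auto intro!: linear_0 bounded_linear.linear
          bounded_clinear_imp_bounded_linear semigroup_ext(1))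
    then show ?thesis
      using linear_0[OF bounded_linear.linear[OF bounded_clinear_imp_bounded_linear[OF bounded_clinear_j]]]
      by (simp add: input_map_def)
  qed
  then show ?thesis
    unfolding admissible_def by (auto simp: X_norm_j Lp_norm_def intro!: exI[of _ 1])
qed

text \<open>The bound for a single element depends on it only through its admissibility constant, so
  the supremum over unit vectors turns it into an operator norm bound.\<close>

lemma resolvent_condition_if_uniformly_admissible:
  assumes q: "q > 0" and half: "{l. Re l > 0} \<subseteq> resolvent_set D A"
    and U: "complex_banach_space U" and B: "bounded_op U B"
    and adm: "\<And>u. \<lbrakk>u \<in> vcarrier U; vnorm U u = 1\<rbrakk> \<Longrightarrow> admissible_element q T j (B u)"
    and C: "C \<ge> 0" "\<And>u. \<lbrakk>u \<in> vcarrier U; vnorm U u = 1\<rbrakk> \<Longrightarrow> admissibility_constant q T j (B u) \<le> C"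
  shows "resolvent_condition q D A j U B"
proof -
  interpret U: complex_banach_space U
    by (rule U)
  have "Re l powr (1 / q) * op_norm U (\<lambda>v. resolvent_ext D A j l (B v)) \<le> C * q powr (- 1 / q)"
    if l: "Re l > 0" for l
  proof -
    define K where "K = C * (q * Re l) powr (- 1 / q)"
    have K: "K \<ge> 0"
      using C(1) by (simp add: K_def)
    have lr: "l \<in> resolvent_set D A"
      using half l by blast
    have unit: "norm (resolvent_ext D A j l (B u)) \<le> K" if u: "u \<in> vcarrier U" "vnorm U u = 1" for u
      unfolding K_def
    proof (rule resolvent_ext_bound[OF lr l q C(1)])
      fix t v assume tv: "t > 0" "v \<in> Lp_space (type_space :: complex normed_space) q t"
      have "X_norm j (input_map T j (element_op (B u)) t v) \<le>
          admissibility_constant q T j (B u) * Lp_norm type_space q t v"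
        by (rule admissibility_constant_bound[OF adm[OF u] tv])
      also have "\<dots> \<le> C * Lp_norm type_space q t v"
        by (rule mult_right_mono[OF C(2)[OF u]]) (simp add: Lp_norm_def)
      finally show "X_norm j (input_map T j (element_op (B u)) t v) \<le> C * Lp_norm type_space q t v" .
    qed
    have "op_norm U (\<lambda>v. resolvent_ext D A j l (B v)) \<le> K"
      unfolding op_norm_def
    proof (rule cSUP_least)
      show "vcarrier U \<noteq> {}"
        using U.zero_closed by blast
      fix x assume x: "x \<in> vcarrier U"
      show "norm (resolvent_ext D A j l (B x)) / vnorm U x \<le> K"
      \<comment> \<open>The supremum in \<open>op_norm\<close> includes the zero vector, whose
        quotient is 0 by the convention on division; this is harmless since \<open>K\<close> is
        nonnegative.\<close>
      proof (cases "vnorm U x = 0")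
        case True
        then show ?thesis
          using K by simp
      next
        case False
        define c where "c = complex_of_real (1 / vnorm U x)"
        have pos: "vnorm U x > 0"
          using False U.norm_nonneg[OF x] by simp
        have "norm (resolvent_ext D A j l (B (vscale U c x))) \<le> K"
          using pos by (intro unit) (simp_all add: U.scale_closed x U.norm_scale c_def norm_divide)
        moreover have "B (vscale U c x) = c *\<^sub>C B x"
          using B x unfolding bounded_op_def by blast
        ultimately show ?thesis
          using pos by (simp add: bounded_clinear_scaleC[OF resolvent_ext(1)[OF lr]] norm_scaleC c_def norm_divide)
      qed
    qed
    then have "Re l powr (1 / q) * op_norm U (\<lambda>v. resolvent_ext D A j l (B v)) \<le> Re l powr (1 / q) * K"
      by (intro mult_left_mono) auto
    also have "\<dots> = C * q powr (- 1 / q)"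
      using l q by (simp add: K_def powr_mult powr_minus_divide)
    finally show ?thesis .
  qed
  then show ?thesis
    unfolding resolvent_condition_def using half by (auto intro!: bdd_aboveI2)
qed

end

theorem theorem5p2:
  fixes T :: "real \<Rightarrow> 'x::complex_banach \<Rightarrow> 'x"
    and D :: "'x set" and A :: "'x \<Rightarrow> 'x"
    and s :: complex and j :: "'x \<Rightarrow> 'y::complex_banach"
    and q :: real
    and U :: "'v normed_space" and B :: "'v \<Rightarrow> 'y"
  assumes "c0_semigroup T"
    and "is_generator D A T"
    and "is_extrapolation_space D A s j"
    and "1 < q"
    and "weiss_property TYPE('v) q D A T j"
    and "complex_banach_space U"
    and "bounded_op U B"
  shows "admissible q T j U B \<longleftrightarrow>
    (\<forall>u\<in>vcarrier U. vnorm U u = 1 \<longrightarrow> admissible_element q T j (B u)) \<and>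
    bdd_above ((\<lambda>u. admissibility_constant q T j (B u)) ` {u \<in> vcarrier U. vnorm U u = 1})"
proof
  assume "admissible q T j U B"
  with assms(6,7) obtain C where "\<And>u. \<lbrakk>u \<in> vcarrier U; vnorm U u = 1\<rbrakk> \<Longrightarrow>
      admissible_element q T j (B u) \<and> admissibility_constant q T j (B u) \<le> C"
    by (rule admissible_imp_uniformly_admissible_elements) blast
  then show "(\<forall>u\<in>vcarrier U. vnorm U u = 1 \<longrightarrow> admissible_element q T j (B u)) \<and>
      bdd_above ((\<lambda>u. admissibility_constant q T j (B u)) ` {u \<in> vcarrier U. vnorm U u = 1})"
    by (intro conjI ballI impI bdd_aboveI2[where M = C]) auto
next
  assume b: "(\<forall>u\<in>vcarrier U. vnorm U u = 1 \<longrightarrow> admissible_element q T j (B u)) \<and>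
      bdd_above ((\<lambda>u. admissibility_constant q T j (B u)) ` {u \<in> vcarrier U. vnorm U u = 1})"
  interpret extrapolated_semigroup T D A s j
    using assms(1-3) by unfold_locales
  \<comment> \<open>The space stays \<open>U\<close> and only the operator varies: the zero operator
    yields the half plane, \<open>B\<close> the conclusion.\<close>
  have weiss: "admissible q T j U B' \<longleftrightarrow> resolvent_condition q D A j U B'" if "bounded_op U B'" for B'
    using assms(5,6) that unfolding weiss_property_def by blast
  \<comment> \<open>The Weiss property for the zero operator gives the inclusion of the half plane in \<open>\<rho>(A)\<close>.\<close>
  have "bounded_op U (\<lambda>_. 0 :: 'y)"
    unfolding bounded_op_def by (intro conjI exI[of _ 0]) simp_all
  then have half: "{l. Re l > 0} \<subseteq> resolvent_set D A"
    using weiss[of "\<lambda>_. 0"] admissible_zero[of q U] unfolding resolvent_condition_def by simp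
  from b obtain C where C: "\<And>u. \<lbrakk>u \<in> vcarrier U; vnorm U u = 1\<rbrakk> \<Longrightarrow> admissibility_constant q T j (B u) \<le> C"
    unfolding bdd_above_def by auto
  have "resolvent_condition q D A j U B"
  proof (rule resolvent_condition_if_uniformly_admissible[OF _ half assms(6,7)])
    show "admissible_element q T j (B u)" if "u \<in> vcarrier U" "vnorm U u = 1" for u
      using b that by blast
    \<comment> \<open>If \<open>U\<close> has no unit vectors, \<open>C\<close> bounds the empty set
      and may be negative.\<close>
    show "admissibility_constant q T j (B u) \<le> max C 0" if "u \<in> vcarrier U" "vnorm U u = 1" for u
      using C[OF that] by simp
  qed (use assms(4) in auto)
  then show "admissible q T j U B"
    using weiss[OF assms(7)] by blast
qed

end
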